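(* Let $1\le p\le 2$ and let $\Omega\subset\mathbb{R}^2$ be a bounded open convex domain containing the origin, with generalized Bochner–Riesz operators $T_\lambda$. Then $T_\lambda$ is unbounded on $L^p(\mathbb{R}^2)$ if $\lambda<1-\frac{\kappa_\Omega}{2}-\frac1p$. In particular, $p_{\mathrm{crit}}\ge\frac{2}{2-\kappa_\Omega}$.
   Context: $\rho(\xi)=\inf\{t>0:t^{-1}\xi\in\Omega\}$; $\mathcal{F}[T_\lambda f](\xi)=(1-\rho(\xi))_+^\lambda\widehat f(\xi)$ for $\lambda>0$ and $\mathcal{F}[T_0f]=\chi_\Omega\widehat f$. A line $\ell$ is a supporting line for $\Omega$ at $p\in\partial\Omega$ if $p\in\ell$ and $\Omega$ lies in the half-plane bounded by $\ell$ containing the origin; $B(p,\ell,\delta)=\{x\in\partial\Omega:\operatorname{dist}(x,\ell)<\delta\}$; $N(\Omega,\delta)$ is the minimal number of such sets covering $\partial\Omega$; $\kappa_\Omega=\limsup_{\delta\to0}\log N(\Omega,\delta)/\log\delta^{-1}$. $p_{\mathrm{crit}}=\inf\{p: T_\lambda\text{ is bounded on }L^p(\mathbb{R}^2)\text{ for all }\lambda>0\}$.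
   Formalization: The printed threshold has the wrong sign (it fails at p=2 for a square, where T_λ is bounded on L^2); what is proved is that T_λ, λ≥0, is unbounded on L^p if λ < 1/p - 1 + κ_Ω/2, together with p_crit ≥ 2/(2-κ_Ω) as stated. *)

theory Defs
  imports "HOL-Analysis.Analysis"
begin

type_synonym R2 = "real ^ 2"

definition fourier2 :: "(R2 \<Rightarrow> complex) \<Rightarrow> R2 \<Rightarrow> complex" where
  "fourier2 f \<xi> = (LINT x|lborel. f x * cis (- 2 * pi * (x \<bullet> \<xi>)))"

definition inv_fourier2 :: "(R2 \<Rightarrow> complex) \<Rightarrow> R2 \<Rightarrow> complex" where
  "inv_fourier2 g x = (LINT \<xi>|lborel. g \<xi> * cis (2 * pi * (x \<bullet> \<xi>)))"

definition gauge :: "R2 set \<Rightarrow> R2 \<Rightarrow> real" where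
  "gauge \<Omega> \<xi> = Inf {t. t > 0 \<and> (inverse t) *\<^sub>R \<xi> \<in> \<Omega>}"

definition br_multiplier :: "R2 set \<Rightarrow> real \<Rightarrow> R2 \<Rightarrow> real" where
  "br_multiplier \<Omega> lam \<xi> =
     (if lam > 0 then (max 0 (1 - gauge \<Omega> \<xi>)) powr lam else indicator \<Omega> \<xi>)"

text \<open>Generalized Bochner--Riesz operator, acting on f in L^1 (so that the
  Fourier transform is given by the absolutely convergent integral).\<close>
definition BR_op :: "R2 set \<Rightarrow> real \<Rightarrow> (R2 \<Rightarrow> complex) \<Rightarrow> R2 \<Rightarrow> complex" where
  "BR_op \<Omega> lam f = inv_fourier2 (\<lambda>\<xi>. complex_of_real (br_multiplier \<Omega> lam \<xi>) * fourier2 f \<xi>)"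

definition in_Lp :: "real \<Rightarrow> (R2 \<Rightarrow> complex) \<Rightarrow> bool" where
  "in_Lp p f \<longleftrightarrow> f \<in> borel_measurable lborel \<and>
     (\<integral>\<^sup>+ x. ennreal (norm (f x) powr p) \<partial>lborel) < \<infinity>"

text \<open>T is bounded on L^p: a uniform L^p estimate on the dense class L^1 \<inter> L^p
  (on which T is defined); equivalently it extends to a bounded operator on L^p.
  Stated with p-th powers of the norms.\<close>
definition bounded_on_Lp :: "((R2 \<Rightarrow> complex) \<Rightarrow> R2 \<Rightarrow> complex) \<Rightarrow> real \<Rightarrow> bool" where
  "bounded_on_Lp T p \<longleftrightarrow> (\<exists>C::real. \<forall>f. integrable lborel f \<and> in_Lp p f \<longrightarrow>
      (\<integral>\<^sup>+ x. ennreal (norm (T f x) powr p) \<partial>lborel)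
        \<le> ennreal C * (\<integral>\<^sup>+ x. ennreal (norm (f x) powr p) \<partial>lborel))"

definition supporting_line :: "R2 set \<Rightarrow> R2 \<Rightarrow> R2 set \<Rightarrow> bool" where
  "supporting_line \<Omega> q L \<longleftrightarrow> q \<in> frontier \<Omega> \<and>
     (\<exists>u c. u \<noteq> 0 \<and> L = {x. x \<bullet> u = c} \<and> q \<in> L \<and> 0 \<le> c \<and> \<Omega> \<subseteq> {x. x \<bullet> u \<le> c})"

definition cap_set :: "R2 set \<Rightarrow> R2 set \<Rightarrow> real \<Rightarrow> R2 set" where
  "cap_set \<Omega> L \<delta> = {x \<in> frontier \<Omega>. infdist x L < \<delta>}"

definition cover_number :: "R2 set \<Rightarrow> real \<Rightarrow> nat" where
  "cover_number \<Omega> \<delta> = (LEAST n. \<exists>S. finite S \<and> card S = n \<and>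
       (\<forall>(q, L)\<in>S. supporting_line \<Omega> q L) \<and>
       frontier \<Omega> \<subseteq> (\<Union>(q, L)\<in>S. cap_set \<Omega> L \<delta>))"

text \<open>kappa_Omega = limsup_{delta -> 0+} log N(Omega,delta) / log(1/delta)
  (finite for bounded convex Omega, so we take its real value).\<close>
definition kappa :: "R2 set \<Rightarrow> real" where
  "kappa \<Omega> = real_of_ereal (Limsup (at_right 0)
      (\<lambda>\<delta>. ereal (ln (real (cover_number \<Omega> \<delta>)) / ln (1 / \<delta>))))"

definition p_crit :: "R2 set \<Rightarrow> real" where
  "p_crit \<Omega> = Inf {p. 1 \<le> p \<and> (\<forall>lam>0. bounded_on_Lp (BR_op \<Omega> lam) p)}"

end

theory Submission
  imports Defs "HOL-Probability.Characteristic_Functions"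
begin

text \<open>
  Apply the operator to a Gaussian: the kernel \<open>K\<close> obtained has Fourier transform \<open>M \<ge> 0\<close>, a positive
  function times the multiplier, and \<open>K\<close> is in \<open>L\<^sup>p\<close> if the operator is bounded. Let \<open>H\<close> be the support
  function of \<open>\<Omega>\<close> and pair \<open>K\<close> with \<open>\<omega>(x) cis (- 2 \<pi> H x)\<close>, where \<open>\<omega>(x) = exp (- \<delta> (x \<bullet> a))\<close> on the sector
  \<open>\<bar>x \<bullet> b\<bar> \<le> x \<bullet> a\<close>. In the coordinates \<open>x = t (a + v b)\<close> the Jacobian is \<open>t\<close>, and since the integral of
  \<open>t exp (- z t)\<close> is \<open>1 / z\<^sup>2\<close>, minus the imaginary part of the pairing is the integral of \<open>M\<close> against a
  kernel in \<open>s = H (a + v b) - \<xi> \<bullet> (a + v b) \<ge> 0\<close> that is nonnegative and comparable to \<open>\<delta> powr (- 2)\<close> for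
  \<open>s\<close> comparable to \<open>\<delta>\<close>. As nothing cancels, the pairing is at least \<open>\<delta> powr (lam - 2)\<close> times the measure of
  the pairs \<open>(v, \<xi>)\<close> such that \<open>\<xi>\<close> has depth about \<open>\<delta>\<close> below the supporting line with normal \<open>a + v b\<close>.
  A greedy choice of supporting lines, each at distance \<open>\<delta>\<close> from the contact point of the preceding
  one, shows that this measure is at least a constant times \<open>\<delta>\<^sup>2 N(\<Omega>, 2 \<delta>)\<close>, up to an error of order \<open>\<delta>\<^sup>2\<close>.
  On the other hand the pairing is at most a constant times \<open>\<delta> powr (2 / p - 2)\<close>. Hence
  \<open>\<kappa> \<le> max 0 (lam + 2 - 2 / p)\<close>, which contradicts \<open>lam < 1 / p - 1 + \<kappa> / 2\<close> and implies the bound on the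
  critical exponent; the latter is the infimum of a nonempty set because of Plancherel's inequality.
\<close>

text \<open>Every nonzero vector is a positive multiple of \<open>a + v b\<close> with \<open>\<bar>v\<bar> \<le> 1\<close> for one of these four frames.\<close>

definition signed_frame :: "R2 \<Rightarrow> R2 \<Rightarrow> bool" where
  "signed_frame a b \<longleftrightarrow> (a, b) \<in> {(axis 1 1, axis 2 1), (- axis 1 1, axis 2 1),
                                (axis 2 1, axis 1 1), (- axis 2 1, axis 1 1)}"

section \<open>Frame coordinates and exchange of integrals\<close>

lemma Basis_R2: "(Basis :: R2 set) = {axis 1 1, axis 2 1}"
  by (auto simp: Basis_vec_def UNIV_2)

lemma axis_neq_R2: "axis 1 1 \<noteq> (axis 2 1 :: R2)"
  by (simp add: axis_eq_axis)

lemma signed_frame_inner: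
  assumes "signed_frame a b"
  shows "a \<bullet> a = 1" "b \<bullet> b = 1" "a \<bullet> b = 0" "b \<bullet> a = 0"
  using assms by (auto simp: signed_frame_def inner_axis_axis)

text \<open>A frame only permutes the axes and possibly reflects one of them, so the preimage of an
  open box is a product of two intervals with the same side lengths; agreement on boxes determines
  Lebesgue measure.\<close>

lemma lborel_signed_frame:
  assumes "signed_frame a b"
  shows "lborel = distr (lborel \<Otimes>\<^sub>M lborel) borel (\<lambda>(s, t). s *\<^sub>R a + t *\<^sub>R b)"
proof (rule lborel_eqI)
  let ?f = "\<lambda>(s::real, t::real). s *\<^sub>R a + t *\<^sub>R b"
  have f[measurable]: "?f \<in> lborel \<Otimes>\<^sub>M lborel \<rightarrow>\<^sub>M borel"
    by (simp add: case_prod_beta)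
  fix l u :: R2 assume lu: "\<And>b. b \<in> Basis \<Longrightarrow> l \<bullet> b \<le> u \<bullet> b"
  then have lu': "l $ 1 \<le> u $ 1" "l $ 2 \<le> u $ 2"
    using lu[of "axis 1 1"] lu[of "axis 2 1"] by (simp_all add: Basis_R2 inner_axis)
  have prod: "(\<Prod>b\<in>Basis. (u - l) \<bullet> b) = (u$1 - l$1) * (u$2 - l$2)"
    by (simp add: Basis_R2 axis_neq_R2 inner_axis)
  \<comment> \<open>\<open>A\<close> is the range of the coefficient of \<open>a\<close> and
    \<open>B\<close> that of the coefficient of \<open>b\<close>; a negative \<open>a\<close>
    reverses its interval.\<close>
  define A B where "A = (if a = axis 1 1 then {l$1<..<u$1} else if a = - axis 1 1 then {-u$1<..<-l$1}
       else if a = axis 2 1 then {l$2<..<u$2} else {-u$2<..<-l$2})"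
    and "B = (if b = axis 2 1 then {l$2<..<u$2} else {l$1<..<u$1})"
  have ne: "axis 1 1 \<noteq> (axis 2 1 :: R2)" "- axis 1 1 \<noteq> (axis 2 1 :: R2)"
    "axis 1 1 \<noteq> (- axis 2 1 :: R2)" "- axis 1 1 \<noteq> (axis 1 1 :: R2)" "- axis 2 1 \<noteq> (axis 2 1 :: R2)"
    "axis 2 1 \<noteq> (axis 1 1 :: R2)" "axis 2 1 \<noteq> (- axis 1 1 :: R2)"
    by (auto simp: vec_eq_iff forall_2 axis_def)
  have "?f -` box l u = A \<times> B"
    using assms ne unfolding signed_frame_def
    by (elim insertE Pair_inject emptyE) (simp_all add: A_def B_def set_eq_iff mem_box_cart forall_2 axis_def, auto)
  moreover have "emeasure (lborel \<Otimes>\<^sub>M lborel) (A \<times> B) = emeasure lborel A * emeasure lborel B"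
    by (rule lborel.emeasure_pair_measure_Times) (auto simp: A_def B_def)
  moreover have "emeasure lborel A * emeasure lborel B = ennreal ((u$1 - l$1) * (u$2 - l$2))"
    using assms lu' ne unfolding signed_frame_def
    by (elim insertE Pair_inject emptyE) (simp_all add: A_def B_def ennreal_mult' mult.commute)
  ultimately show "emeasure (distr (lborel \<Otimes>\<^sub>M lborel) borel ?f) (box l u) = (\<Prod>b\<in>Basis. (u - l) \<bullet> b)"
    by (subst emeasure_distr) (auto simp: space_pair_measure prod)
qed simp

text \<open>The product of \<open>u\<close> and \<open>v\<close> is integrable on the product space,
  and a bounded factor keeps it so, hence Fubini applies. Serves for the Fourier kernel as well as
  for the kernel of the sector pairing.\<close>

lemma bounded_kernel_integral_swap:
  fixes u :: "'a \<Rightarrow> complex" and v :: "'b \<Rightarrow> complex" and k :: "'a \<Rightarrow> 'b \<Rightarrow> complex"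
  assumes "sigma_finite_measure M" "sigma_finite_measure N"
    and u: "integrable M u" and v: "integrable N v"
    and k[measurable]: "case_prod k \<in> borel_measurable (M \<Otimes>\<^sub>M N)"
    and k1: "\<And>x y. norm (k x y) \<le> C"
  shows "(LINT x|M. u x * (LINT y|N. v y * k x y)) = (LINT y|N. v y * (LINT x|M. u x * k x y))"
proof -
  interpret pair_sigma_finite M N using assms by (simp add: pair_sigma_finite_def)
  have [measurable]: "u \<in> borel_measurable M" "v \<in> borel_measurable N" using u v by auto
  have uv: "integrable (M \<Otimes>\<^sub>M N) (\<lambda>(x, y). u x * v y)"
  proof (rule Fubini_integrable)
    show "integrable M (\<lambda>x. LINT y|N. norm (case (x, y) of (x, y) \<Rightarrow> u x * v y))"
      using u by (simp add: norm_mult)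
  qed (use v in auto)
  have i: "integrable (M \<Otimes>\<^sub>M N) (\<lambda>(x, y). u x * v y * k x y)"
  proof (rule Bochner_Integration.integrable_bound)
    show "integrable (M \<Otimes>\<^sub>M N) (\<lambda>z. C *\<^sub>R (case z of (x, y) \<Rightarrow> u x * v y))"
      using uv by simp
    show "AE z in M \<Otimes>\<^sub>M N. norm (case z of (x, y) \<Rightarrow> u x * v y * k x y) \<le> norm (C *\<^sub>R (case z of (x, y) \<Rightarrow> u x * v y))"
    proof (rule AE_I2, clarify)
      fix x y show "norm (u x * v y * k x y) \<le> norm (C *\<^sub>R (u x * v y))"
        unfolding norm_mult norm_scaleR using k1[of x y]
        by (subst mult.commute, intro mult_right_mono) auto
    qed
  qed measurable
  have "(LINT x|M. u x * (LINT y|N. v y * k x y)) = (LINT x|M. LINT y|N. u x * v y * k x y)"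
    by (simp add: mult.assoc)
  also have "\<dots> = (LINT y|N. LINT x|M. u x * v y * k x y)"
    using Fubini_integral[OF i] by simp
  also have "(\<lambda>y x. u x * v y * k x y) = (\<lambda>y x. v y * (u x * k x y))"
    by (simp add: fun_eq_iff)
  finally show ?thesis by simp
qed

subsection \<open>Gaussians and the Plancherel inequality\<close>

lemma measurable_cis[measurable]: "cis \<in> borel_measurable borel"
  by (intro borel_measurable_continuous_onI continuous_intros)

text \<open>Rescaling by \<open>sqrt s\<close> reduces both claims to the characteristic function of
  the standard normal distribution.\<close>

lemma gaussian_1d:
  fixes s u :: real
  assumes s: "s > 0"
  shows "integrable lborel (\<lambda>x. complex_of_real (exp (- s * x\<^sup>2 / 2)) * cis (u * x))" (is ?I)
    and "(LINT x|lborel. complex_of_real (exp (- s * x\<^sup>2 / 2)) * cis (u * x))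
           = complex_of_real (sqrt (2 * pi / s) * exp (- u\<^sup>2 / (2 * s)))" (is ?E)
proof -
  define r where "r = sqrt s"
  have r: "r > 0" "r\<^sup>2 = s" using s by (auto simp: r_def)
  let ?g = "\<lambda>t y. std_normal_density y *\<^sub>R iexp (t * y)"
  have ig: "integrable lborel (?g t)" for t
  proof (rule Bochner_Integration.integrable_bound[of _ std_normal_density])
    show "integrable lborel std_normal_density" by simp
  qed (auto simp: norm_mult)
  have eg: "(LINT y|lborel. ?g t y) = complex_of_real (exp (- t\<^sup>2 / 2))" for t
    using fun_cong[OF char_std_normal_distribution, of t] unfolding char_def
    by (subst (asm) integral_density) auto
  have eq: "complex_of_real (exp (- s * x\<^sup>2 / 2)) * cis (u * x) = sqrt (2 * pi) *\<^sub>R ?g (u / r) (0 + r * x)" for x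
    using r by (simp add: std_normal_density_def scaleR_conv_of_real cis_conv_exp power_mult_distrib)
  have "integrable lborel (\<lambda>x. ?g (u / r) (0 + r * x))"
    using lborel_integrable_real_affine[OF ig, of r] r by blast
  then show ?I unfolding eq by (rule integrable_scaleR_right)
  have "(LINT x|lborel. complex_of_real (exp (- s * x\<^sup>2 / 2)) * cis (u * x))
      = sqrt (2 * pi) *\<^sub>R (LINT x|lborel. ?g (u / r) (0 + r * x))"
    unfolding eq by (rule integral_scaleR_right)
  also have "(LINT x|lborel. ?g (u / r) (0 + r * x)) = (1 / r) *\<^sub>R (LINT y|lborel. ?g (u / r) y)"
    using lborel_integral_real_affine[of r "?g (u / r)" 0] r by simp
  also have "sqrt (2 * pi) *\<^sub>R (1 / r) *\<^sub>R (LINT y|lborel. ?g (u / r) y)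
      = complex_of_real (sqrt (2 * pi / s) * exp (- u\<^sup>2 / (2 * s)))"
    unfolding eg using r by (simp add: scaleR_conv_of_real real_sqrt_divide r_def[symmetric] power_divide)
  finally show ?E .
qed

text \<open>In the coordinate frame the integrand is a product of two one-dimensional Gaussians. The
  parameter \<open>s\<close> stays free: \<open>s = 1\<close> gives the test function, and small
  \<open>s\<close> gives the weights for Plancherel.\<close>

lemma gaussian_2d:
  fixes s :: real
  assumes s: "s > 0"
  shows "integrable lborel (\<lambda>x::R2. exp (- s * (norm x)\<^sup>2 / 2))" (is ?I)
    and "fourier2 (\<lambda>x. complex_of_real (exp (- s * (norm x)\<^sup>2 / 2))) \<xi>
           = complex_of_real (2 * pi / s * exp (- 2 * pi\<^sup>2 * (norm \<xi>)\<^sup>2 / s))" (is ?E)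
proof -
  let ?a = "axis 1 1 :: R2" and ?b = "axis 2 1 :: R2"
  let ?f = "\<lambda>(p::real, q::real). p *\<^sub>R ?a + q *\<^sub>R ?b"
  have fr: "signed_frame ?a ?b" by (simp add: signed_frame_def)
  note dst = lborel_signed_frame[OF fr]
  have fm: "?f \<in> lborel \<Otimes>\<^sub>M lborel \<rightarrow>\<^sub>M borel" by (simp add: case_prod_beta)
  have nrm: "(norm (p *\<^sub>R ?a + q *\<^sub>R ?b))\<^sup>2 = p\<^sup>2 + q\<^sup>2" for p q
    unfolding power2_norm_eq_inner
    by (simp add: inner_add_left inner_add_right inner_axis_axis power2_eq_square)
  let ?h = "\<lambda>u p. complex_of_real (exp (- s * p\<^sup>2 / 2)) * cis (u * p)"
  let ?u = "\<lambda>i. - 2 * pi * \<xi> $ i"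
  let ?G = "\<lambda>x. complex_of_real (exp (- s * (norm x)\<^sup>2 / 2)) * cis (- 2 * pi * (x \<bullet> \<xi>))"
  have Gf: "?G (p *\<^sub>R ?a + q *\<^sub>R ?b) = ?h (?u 1) p * ?h (?u 2) q" for p q
  proof -
    have e: "exp (- s * (p\<^sup>2 + q\<^sup>2) / 2) = exp (- s * p\<^sup>2 / 2) * exp (- s * q\<^sup>2 / 2)"
      by (simp add: exp_add[symmetric] field_simps)
    have c: "cis (- 2 * pi * ((p *\<^sub>R ?a + q *\<^sub>R ?b) \<bullet> \<xi>)) = cis (?u 1 * p) * cis (?u 2 * q)"
      by (simp add: cis_mult inner_add_left inner_axis' algebra_simps)
    show ?thesis unfolding nrm e c by simp
  qed
  have ih: "integrable (lborel \<Otimes>\<^sub>M lborel) (\<lambda>(p, q). ?h (?u 1) p * ?h (?u 2) q)"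
  proof (rule lborel_pair.Fubini_integrable)
    have "integrable lborel (\<lambda>p. norm (?h (?u 1) p))" by (intro integrable_norm gaussian_1d s)
    then show "integrable lborel (\<lambda>x. LINT y|lborel. norm (case (x, y) of (p, q) \<Rightarrow> ?h (?u 1) p * ?h (?u 2) q))"
      by (simp add: norm_mult)
    show "AE x in lborel. integrable lborel (\<lambda>y. case (x, y) of (p, q) \<Rightarrow> ?h (?u 1) p * ?h (?u 2) q)"
      using gaussian_1d(1)[OF s, of "?u 2"] by auto
  qed measurable
  have Gc: "(\<lambda>z. ?G (?f z)) = (\<lambda>(p, q). ?h (?u 1) p * ?h (?u 2) q)"
    using Gf by (intro ext) (simp only: split_paired_all prod.case)
  have Gm: "?G \<in> borel_measurable borel" by measurable
  have "integrable (distr (lborel \<Otimes>\<^sub>M lborel) borel ?f) ?G"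
    using ih unfolding integrable_distr_eq[OF fm Gm] Gc .
  then have iG: "integrable lborel ?G" by (subst dst)
  then show ?I
    using integrable_norm[OF iG] by (simp add: norm_mult)
  have "fourier2 (\<lambda>x. complex_of_real (exp (- s * (norm x)\<^sup>2 / 2))) \<xi> = (LINT x|(distr (lborel \<Otimes>\<^sub>M lborel) borel ?f). ?G x)"
    unfolding fourier2_def by (rule arg_cong[OF dst])
  also have "\<dots> = integral\<^sup>L (lborel \<Otimes>\<^sub>M lborel) (\<lambda>(p, q). ?h (?u 1) p * ?h (?u 2) q)"
    unfolding integral_distr[OF fm Gm] Gc ..
  also have "\<dots> = (LINT p|lborel. LINT q|lborel. ?h (?u 1) p * ?h (?u 2) q)"
    using lborel_pair.integral_fst'[OF ih] by simp
  also have "\<dots> = (LINT p|lborel. ?h (?u 1) p) * (LINT q|lborel. ?h (?u 2) q)"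
    by simp
  also have "\<dots> = complex_of_real (2 * pi / s * exp (- 2 * pi\<^sup>2 * (norm \<xi>)\<^sup>2 / s))"
  proof -
    have n: "(norm \<xi>)\<^sup>2 = (\<xi> $ 1)\<^sup>2 + (\<xi> $ 2)\<^sup>2"
      unfolding power2_norm_eq_inner by (simp add: inner_vec_def sum_2 power2_eq_square)
    have sq: "sqrt (2 * pi / s) * sqrt (2 * pi / s) = 2 * pi / s" using s by simp
    have "exp (- (?u 1)\<^sup>2 / (2 * s)) * exp (- (?u 2)\<^sup>2 / (2 * s)) = exp (- 2 * pi\<^sup>2 * (norm \<xi>)\<^sup>2 / s)"
      unfolding exp_add[symmetric] n using s by (simp add: field_simps power2_eq_square)
    moreover have "(r * e) * (r * e') = (r * r) * (e * e')" for r e e' :: real by simp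
    ultimately show ?thesis
      unfolding gaussian_1d(2)[OF s] of_real_mult[symmetric] by (simp only: sq)
  qed
  finally show ?E .
qed

text \<open>If \<open>f\<close> is not integrable, its Bochner integral is 0 by convention.\<close>

lemma ennreal_norm_integral_le:
  fixes f :: "'a \<Rightarrow> 'b::{banach, second_countable_topology}"
  shows "ennreal (norm (LINT x|M. f x)) \<le> (\<integral>\<^sup>+ x. ennreal (norm (f x)) \<partial>M)"
  by (cases "integrable M f") (auto simp: integral_norm_bound_ennreal not_integrable_integral_eq)

lemma integrable_mult_cis:
  fixes f :: "'a \<Rightarrow> complex"
  assumes f: "integrable M f" and [measurable]: "g \<in> borel_measurable M"
  shows "integrable M (\<lambda>x. f x * cis (g x))"
proof -
  have [measurable]: "f \<in> borel_measurable M" using f by simp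
  show ?thesis by (rule Bochner_Integration.integrable_bound[OF f]) (auto simp: norm_mult)
qed

lemma measurable_fourier2[measurable]:
  assumes [measurable]: "f \<in> borel_measurable borel"
  shows "fourier2 f \<in> borel_measurable borel"
  unfolding fourier2_def by measurable

lemma norm_fourier2_le:
  "norm (fourier2 f \<xi>) \<le> (LINT x|lborel. norm (f x))"
  unfolding fourier2_def by (rule order_trans[OF integral_norm_bound]) (simp add: norm_mult)

lemma cnj_fourier2: "cnj (fourier2 f \<xi>) = (LINT x|lborel. cnj (f x) * cis (2 * pi * (x \<bullet> \<xi>)))"
  unfolding fourier2_def by (subst Bochner_Integration.integral_cnj[symmetric]) (simp add: cis_cnj)

lemma nn_integral_lborel_translate:
  fixes g :: "'a::euclidean_space \<Rightarrow> ennreal"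
  assumes [measurable]: "g \<in> borel_measurable borel"
  shows "(\<integral>\<^sup>+ x. g (c + x) \<partial>lborel) = (\<integral>\<^sup>+ x. g x \<partial>lborel)"
proof -
  have "(\<integral>\<^sup>+ x. g x \<partial>lborel) = (\<integral>\<^sup>+ x. g x \<partial>(distr lborel borel ((+) c)))"
    by (simp add: lborel_distr_plus)
  then show ?thesis by (simp add: nn_integral_distr)
qed

text \<open>Schur's test: bound \<open>F y * F x\<close> by half the sum of the squares; then
  \<open>g (x - y)\<close> integrates to 1 in either variable, in \<open>y\<close> because
  \<open>g\<close> is even.\<close>

lemma schur_convolution_le:
  fixes F :: "'a::euclidean_space \<Rightarrow> real" and g :: "'a \<Rightarrow> real"
  assumes [measurable]: "F \<in> borel_measurable borel" "g \<in> borel_measurable borel"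
    and F: "\<And>x. F x \<ge> 0" and g: "\<And>x. g x \<ge> 0" and even: "\<And>x. g (- x) = g x"
    and g1: "(\<integral>\<^sup>+ x. ennreal (g x) \<partial>lborel) = 1"
  shows "(\<integral>\<^sup>+ y. \<integral>\<^sup>+ x. ennreal (F y * (F x * g (x - y))) \<partial>lborel \<partial>lborel)
       \<le> (\<integral>\<^sup>+ x. ennreal ((F x)\<^sup>2) \<partial>lborel)"
proof -
  have gx: "(\<integral>\<^sup>+ x. ennreal (g (x - y)) \<partial>lborel) = 1" for y
    using nn_integral_lborel_translate[of "\<lambda>x. ennreal (g x)" "- y"] g1 by simp
  have gy: "(\<integral>\<^sup>+ y. ennreal (g (x - y)) \<partial>lborel) = 1" for x
    using gx[of x] even[of "_ - x"] by (metis (mono_tags, lifting) minus_diff_eq nn_integral_cong)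
  let ?S = "\<integral>\<^sup>+ x. ennreal ((F x)\<^sup>2) \<partial>lborel"
  have "(\<integral>\<^sup>+ y. \<integral>\<^sup>+ x. ennreal (F y * (F x * g (x - y))) \<partial>lborel \<partial>lborel)
      \<le> (\<integral>\<^sup>+ y. \<integral>\<^sup>+ x. ennreal (1/2) * (ennreal ((F y)\<^sup>2) * ennreal (g (x - y)))
            + ennreal (1/2) * (ennreal ((F x)\<^sup>2) * ennreal (g (x - y))) \<partial>lborel \<partial>lborel)"
  proof (intro nn_integral_mono)
    fix y x
    have "F y * F x \<le> 1/2 * (F y)\<^sup>2 + 1/2 * (F x)\<^sup>2"
      using sum_squares_bound[of "F y" "F x"] by simp
    then have "F y * F x * g (x - y) \<le> (1/2 * (F y)\<^sup>2 + 1/2 * (F x)\<^sup>2) * g (x - y)"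
      by (rule mult_right_mono[OF _ g])
    then have "ennreal (F y * (F x * g (x - y)))
        \<le> ennreal (1/2 * ((F y)\<^sup>2 * g (x - y)) + 1/2 * ((F x)\<^sup>2 * g (x - y)))"
      by (intro ennreal_leI) (simp add: algebra_simps)
    also have "\<dots> = ennreal (1/2) * (ennreal ((F y)\<^sup>2) * ennreal (g (x - y)))
            + ennreal (1/2) * (ennreal ((F x)\<^sup>2) * ennreal (g (x - y)))"
    proof -
      have h: "ennreal (1/2 * (z\<^sup>2 * g (x - y))) = ennreal (1/2) * (ennreal (z\<^sup>2) * ennreal (g (x - y)))" for z
        by (simp only: ennreal_mult g mult_nonneg_nonneg zero_le_power2 zero_le_divide_1_iff zero_le_numeral)
      show ?thesis unfolding h[symmetric] using g by (intro ennreal_plus) auto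
    qed
    finally show "ennreal (F y * (F x * g (x - y))) \<le> \<dots>" .
  qed
  also have "\<dots> = ennreal (1/2) * (\<integral>\<^sup>+ y. \<integral>\<^sup>+ x. ennreal ((F y)\<^sup>2) * ennreal (g (x - y)) \<partial>lborel \<partial>lborel)
      + ennreal (1/2) * (\<integral>\<^sup>+ y. \<integral>\<^sup>+ x. ennreal ((F x)\<^sup>2) * ennreal (g (x - y)) \<partial>lborel \<partial>lborel)"
    by (simp add: nn_integral_add nn_integral_cmult)
  also have "(\<integral>\<^sup>+ y. \<integral>\<^sup>+ x. ennreal ((F y)\<^sup>2) * ennreal (g (x - y)) \<partial>lborel \<partial>lborel) = ?S"
    by (simp add: nn_integral_cmult gx)
  also have "(\<integral>\<^sup>+ y. \<integral>\<^sup>+ x. ennreal ((F x)\<^sup>2) * ennreal (g (x - y)) \<partial>lborel \<partial>lborel)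
      = (\<integral>\<^sup>+ x. \<integral>\<^sup>+ y. ennreal ((F x)\<^sup>2) * ennreal (g (x - y)) \<partial>lborel \<partial>lborel)"
    by (rule lborel_pair.Fubini'[symmetric]) measurable
  also have "\<dots> = ?S" by (simp add: nn_integral_cmult gy)
  also have "ennreal (1/2) * ?S + ennreal (1/2) * ?S = ?S"
  proof -
    have "ennreal (1/2) + ennreal (1/2) = 1"
      by (subst ennreal_plus[symmetric]) auto
    then show ?thesis by (metis distrib_right mult_1)
  qed
  finally show ?thesis .
qed

text \<open>The weight makes every integral absolutely convergent. The weighted square norm of the
  transform becomes the form pairing \<open>f\<close> with its convolution with a Gaussian of mass
  1, to which Schur's test applies.\<close>

lemma fourier2_gaussian_weighted_le:
  assumes f: "integrable lborel f" and s: "s > 0"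
  shows "(\<integral>\<^sup>+ \<xi>. ennreal (exp (- s * (norm \<xi>)\<^sup>2 / 2) * (norm (fourier2 f \<xi>))\<^sup>2) \<partial>lborel)
      \<le> (\<integral>\<^sup>+ x. ennreal ((norm (f x))\<^sup>2) \<partial>lborel)"
proof -
  define w where "w \<xi> = exp (- s * (norm \<xi>)\<^sup>2 / 2)" for \<xi> :: R2
  \<comment> \<open>The Fourier transform of the weight \<open>w\<close>, an even probability
    density.\<close>
  define g where "g z = 2 * pi / s * exp (- 2 * pi\<^sup>2 * (norm z)\<^sup>2 / s)" for z :: R2
  have [measurable]: "f \<in> borel_measurable borel" using f by simp
  have [measurable]: "w \<in> borel_measurable borel" "g \<in> borel_measurable borel"
    unfolding w_def g_def by measurable
  have wi: "integrable lborel w" unfolding w_def by (rule gaussian_2d[OF s])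
  have g1: "(\<integral>\<^sup>+ x. ennreal (g x) \<partial>lborel) = 1"
  proof -
    \<comment> \<open>With this parameter \<open>g\<close> is a multiple of a Gaussian covered by
      \<open>gaussian_2d\<close>; its mass is read off from the Fourier transform at 0.\<close>
    let ?s = "4 * pi\<^sup>2 / s"
    have s': "?s > 0" using s by simp
    have g_eq: "g z = 2 * pi / s * exp (- ?s * (norm z)\<^sup>2 / 2)" for z
      unfolding g_def by (simp add: field_simps)
    have "integrable lborel g" unfolding g_eq by (intro integrable_mult_right gaussian_2d s')
    moreover have "(LINT x|lborel. g x) = 1"
    proof -
      have "complex_of_real (LINT x|lborel. exp (- ?s * (norm (x::R2))\<^sup>2 / 2)) = complex_of_real (2 * pi / ?s)"
        using gaussian_2d(2)[OF s', of 0] by (simp add: fourier2_def integral_complex_of_real)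
      then have "(LINT x|lborel. exp (- ?s * (norm (x::R2))\<^sup>2 / 2)) = 2 * pi / ?s"
        using of_real_eq_iff by blast
      then show ?thesis unfolding g_eq using s by (simp add: field_simps power2_eq_square)
    qed
    moreover have "g x \<ge> 0" for x using s by (simp add: g_def)
    ultimately show ?thesis by (simp add: nn_integral_eq_integral)
  qed
  define B where "B = (LINT x|lborel. norm (f x))"
  have fB: "norm (fourier2 f \<xi>) \<le> B" for \<xi> unfolding B_def by (rule norm_fourier2_le)
  have uw: "integrable lborel (\<lambda>\<xi>. complex_of_real (w \<xi>) * fourier2 f \<xi>)"
  proof (rule Bochner_Integration.integrable_bound)
    show "integrable lborel (\<lambda>\<xi>. B * w \<xi>)" using wi by simp
    have "B \<ge> 0" unfolding B_def by simp
    then show "AE \<xi> in lborel. norm (complex_of_real (w \<xi>) * fourier2 f \<xi>) \<le> norm (B * w \<xi>)"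
      using fB by (auto simp: norm_mult abs_mult mult.commute[of B] intro!: AE_I2 mult_left_mono)
  qed measurable
  have sf: "sigma_finite_measure lborel" by unfold_locales
  \<comment> \<open>Inverting the weighted transform of \<open>f\<close> gives the convolution of
    \<open>f\<close> with \<open>g\<close>.\<close>
  have inner: "(LINT \<xi>|lborel. (complex_of_real (w \<xi>) * fourier2 f \<xi>) * cis (2 * pi * (y \<bullet> \<xi>)))
      = (LINT x|lborel. f x * complex_of_real (g (x - y)))" for y
  proof -
    have "(LINT \<xi>|lborel. (complex_of_real (w \<xi>) * fourier2 f \<xi>) * cis (2 * pi * (y \<bullet> \<xi>)))
      = (LINT \<xi>|lborel. (complex_of_real (w \<xi>) * cis (2 * pi * (y \<bullet> \<xi>))) * (LINT x|lborel. f x * cis (- 2 * pi * (x \<bullet> \<xi>))))"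
      by (simp add: fourier2_def ac_simps)
    also have "\<dots> = (LINT x|lborel. f x * (LINT \<xi>|lborel. (complex_of_real (w \<xi>) * cis (2 * pi * (y \<bullet> \<xi>))) * cis (- 2 * pi * (x \<bullet> \<xi>))))"
      by (rule bounded_kernel_integral_swap[where C = 1, OF sf sf integrable_mult_cis f])
         (use wi in \<open>auto simp: case_prod_beta'\<close>)
    also have "(\<lambda>x. LINT \<xi>|lborel. (complex_of_real (w \<xi>) * cis (2 * pi * (y \<bullet> \<xi>))) * cis (- 2 * pi * (x \<bullet> \<xi>)))
        = (\<lambda>x. complex_of_real (g (x - y)))"
    proof
      fix x
      have "(LINT \<xi>|lborel. (complex_of_real (w \<xi>) * cis (2 * pi * (y \<bullet> \<xi>))) * cis (- 2 * pi * (x \<bullet> \<xi>)))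
          = fourier2 (\<lambda>\<xi>. complex_of_real (w \<xi>)) (x - y)"
        unfolding fourier2_def mult.assoc cis_mult
        by (simp add: inner_diff_right inner_commute algebra_simps)
      also have "\<dots> = complex_of_real (g (x - y))"
        unfolding w_def g_def by (rule gaussian_2d[OF s])
      finally show "(LINT \<xi>|lborel. (complex_of_real (w \<xi>) * cis (2 * pi * (y \<bullet> \<xi>))) * cis (- 2 * pi * (x \<bullet> \<xi>)))
         = complex_of_real (g (x - y))" .
    qed
    finally show ?thesis .
  qed
  \<comment> \<open>Write the square as the transform times its conjugate and unfold only the
    conjugate; after the exchange the inner integral is the one just computed.\<close>
  have "complex_of_real (LINT \<xi>|lborel. w \<xi> * (norm (fourier2 f \<xi>))\<^sup>2)
      = (LINT \<xi>|lborel. complex_of_real (w \<xi>) * fourier2 f \<xi> * cnj (fourier2 f \<xi>))"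
    unfolding integral_complex_of_real[symmetric] by (simp add: complex_norm_square mult.assoc del: of_real_power)
  also have "\<dots> = (LINT \<xi>|lborel. complex_of_real (w \<xi>) * fourier2 f \<xi> * (LINT y|lborel. cnj (f y) * cis (2 * pi * (y \<bullet> \<xi>))))"
    by (simp only: cnj_fourier2)
  also have "\<dots> = (LINT y|lborel. cnj (f y) * (LINT \<xi>|lborel. (complex_of_real (w \<xi>) * fourier2 f \<xi>) * cis (2 * pi * (y \<bullet> \<xi>))))"
    by (rule bounded_kernel_integral_swap[where C = 1, OF sf sf uw]) (use f in \<open>auto simp: case_prod_beta'\<close>)
  also have "\<dots> = (LINT y|lborel. cnj (f y) * (LINT x|lborel. f x * complex_of_real (g (x - y))))"
    by (simp only: inner)
  finally have main: "complex_of_real (LINT \<xi>|lborel. w \<xi> * (norm (fourier2 f \<xi>))\<^sup>2) = \<dots>" .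
  have w0: "w \<xi> \<ge> 0" and g0: "g \<xi> \<ge> 0" for \<xi> using s by (auto simp: w_def g_def)
  have int: "integrable lborel (\<lambda>\<xi>. w \<xi> * (norm (fourier2 f \<xi>))\<^sup>2)"
  proof (rule Bochner_Integration.integrable_bound)
    show "integrable lborel (\<lambda>\<xi>. B\<^sup>2 * w \<xi>)" using wi by simp
    show "AE \<xi> in lborel. norm (w \<xi> * (norm (fourier2 f \<xi>))\<^sup>2) \<le> norm (B\<^sup>2 * w \<xi>)"
      using fB w0 by (auto simp: abs_mult mult.commute[of "B\<^sup>2"] intro!: AE_I2 mult_left_mono power_mono)
  qed measurable
  have "(\<integral>\<^sup>+ \<xi>. ennreal (w \<xi> * (norm (fourier2 f \<xi>))\<^sup>2) \<partial>lborel)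
      = ennreal (LINT \<xi>|lborel. w \<xi> * (norm (fourier2 f \<xi>))\<^sup>2)"
    using int w0 by (intro nn_integral_eq_integral) auto
  also have "\<dots> = ennreal (norm (complex_of_real (LINT \<xi>|lborel. w \<xi> * (norm (fourier2 f \<xi>))\<^sup>2)))"
    using w0 by simp
  also have "\<dots> \<le> (\<integral>\<^sup>+ y. ennreal (norm (cnj (f y) * (LINT x|lborel. f x * complex_of_real (g (x - y))))) \<partial>lborel)"
    unfolding main by (rule ennreal_norm_integral_le)
  also have "\<dots> \<le> (\<integral>\<^sup>+ y. \<integral>\<^sup>+ x. ennreal (norm (f y) * (norm (f x) * g (x - y))) \<partial>lborel \<partial>lborel)"
  proof (rule nn_integral_mono)
    fix y
    have "ennreal (norm (cnj (f y) * (LINT x|lborel. f x * complex_of_real (g (x - y)))))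
      \<le> ennreal (norm (f y)) * (\<integral>\<^sup>+ x. ennreal (norm (f x * complex_of_real (g (x - y)))) \<partial>lborel)"
      unfolding norm_mult complex_mod_cnj
      by (subst ennreal_mult) (auto intro!: mult_left_mono order_trans[OF ennreal_norm_integral_le] simp: norm_mult)
    also have "\<dots> = (\<integral>\<^sup>+ x. ennreal (norm (f y) * (norm (f x) * g (x - y))) \<partial>lborel)"
      using g0 by (subst nn_integral_cmult[symmetric]) (auto simp: norm_mult ennreal_mult)
    finally show "ennreal (norm (cnj (f y) * (LINT x|lborel. f x * complex_of_real (g (x - y))))) \<le> \<dots>" .
  qed
  also have "\<dots> \<le> (\<integral>\<^sup>+ x. ennreal ((norm (f x))\<^sup>2) \<partial>lborel)"
    by (rule schur_convolution_le) (auto simp: g0 g1, auto simp: g_def)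
  finally show ?thesis unfolding w_def .
qed

text \<open>Fatou's lemma along weights whose parameter tends to 0. The right-hand side may be
  infinite.\<close>

lemma plancherel_le:
  assumes f: "integrable lborel f"
  shows "(\<integral>\<^sup>+ \<xi>. ennreal ((norm (fourier2 f \<xi>))\<^sup>2) \<partial>lborel) \<le> (\<integral>\<^sup>+ x. ennreal ((norm (f x))\<^sup>2) \<partial>lborel)"
proof -
  have [measurable]: "f \<in> borel_measurable borel" using f by simp
  let ?g = "\<lambda>n \<xi>. ennreal (exp (- inverse (real (Suc n)) * (norm \<xi>)\<^sup>2 / 2) * (norm (fourier2 f \<xi>))\<^sup>2)"
  have lim: "(\<lambda>n. ?g n \<xi>) \<longlonglongrightarrow> ennreal ((norm (fourier2 f \<xi>))\<^sup>2)" for \<xi>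
  proof (rule tendsto_ennrealI)
    have "(\<lambda>n. exp (- inverse (real (Suc n)) * (norm \<xi>)\<^sup>2 / 2) * (norm (fourier2 f \<xi>))\<^sup>2)
        \<longlonglongrightarrow> exp (- 0 * (norm \<xi>)\<^sup>2 / 2) * (norm (fourier2 f \<xi>))\<^sup>2"
      by (intro tendsto_intros LIMSEQ_inverse_real_of_nat) auto
    then show "(\<lambda>n. exp (- inverse (real (Suc n)) * (norm \<xi>)\<^sup>2 / 2) * (norm (fourier2 f \<xi>))\<^sup>2)
        \<longlonglongrightarrow> (norm (fourier2 f \<xi>))\<^sup>2" by simp
  qed
  have "(\<integral>\<^sup>+ \<xi>. ennreal ((norm (fourier2 f \<xi>))\<^sup>2) \<partial>lborel) = (\<integral>\<^sup>+ \<xi>. liminf (\<lambda>n. ?g n \<xi>) \<partial>lborel)"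
    using lim_imp_Liminf[OF _ lim] by simp
  also have "\<dots> \<le> liminf (\<lambda>n. \<integral>\<^sup>+ \<xi>. ?g n \<xi> \<partial>lborel)"
    by (rule nn_integral_liminf) measurable
  also have "\<dots> \<le> (\<integral>\<^sup>+ x. ennreal ((norm (f x))\<^sup>2) \<partial>lborel)"
    using fourier2_gaussian_weighted_le[OF f, of "inverse (real (Suc _))"]
    by (intro Liminf_le) (auto simp del: of_nat_Suc)
  finally show ?thesis .
qed

subsection \<open>The gauge and the multiplier\<close>

lemma inv_fourier2_eq: "inv_fourier2 g x = fourier2 g (- x)"
  unfolding inv_fourier2_def fourier2_def by (simp add: inner_commute)

lemma lborel_distr_reflect: "distr lborel borel uminus = (lborel :: 'a::euclidean_space measure)"
  using lborel_affine[of "- 1 :: real" "0 :: 'a"] by (simp add: density_1 one_ennreal_def[symmetric])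

locale convex_domain =
  fixes \<Omega> :: "R2 set"
  assumes bounded_domain: "bounded \<Omega>" and open_domain: "open \<Omega>"
    and convex: "convex \<Omega>" and zero: "0 \<in> \<Omega>"
begin

lemma scale_mem: "x \<in> \<Omega> \<Longrightarrow> 0 \<le> t \<Longrightarrow> t \<le> 1 \<Longrightarrow> t *\<^sub>R x \<in> \<Omega>"
  using convexD_alt[OF convex zero, of x t] by simp

lemma gauge_bdd_below: "bdd_below {t. t > 0 \<and> inverse t *\<^sub>R \<xi> \<in> \<Omega>}"
  by (rule bdd_belowI[of _ 0]) auto

lemma gauge_nonempty: "{t. t > 0 \<and> inverse t *\<^sub>R \<xi> \<in> \<Omega>} \<noteq> {}"
proof -
  obtain e where e: "e > 0" "ball 0 e \<subseteq> \<Omega>" using open_domain zero openE by blast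
  have "norm \<xi> / (norm \<xi> + 1) < 1" by (simp add: add_nonneg_pos)
  then have "e * (norm \<xi> / (norm \<xi> + 1)) < e"
    using mult_strict_left_mono[OF _ e(1), of "norm \<xi> / (norm \<xi> + 1)" 1] by simp
  then have "inverse ((norm \<xi> + 1) / e) *\<^sub>R \<xi> \<in> ball 0 e"
    using e(1) by (simp add: divide_simps add_nonneg_pos mult.commute)
  then show ?thesis using e by (intro CollectI exI[of _ "(norm \<xi> + 1) / e"] Set.ex_in_conv[THEN iffD1]) (auto simp: add_nonneg_pos)
qed

lemma gauge_nonneg: "gauge \<Omega> \<xi> \<ge> 0"
  unfolding gauge_def by (rule cInf_greatest[OF gauge_nonempty]) auto

text \<open>One direction is star-shapedness about 0. The other uses openness: membership persists
  for slightly smaller \<open>t\<close>, which makes the inequality strict.\<close>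

lemma gauge_less_iff:
  assumes t: "t > 0"
  shows "gauge \<Omega> \<xi> < t \<longleftrightarrow> inverse t *\<^sub>R \<xi> \<in> \<Omega>"
proof
  assume "gauge \<Omega> \<xi> < t"
  then obtain s where s: "s > 0" "inverse s *\<^sub>R \<xi> \<in> \<Omega>" "s < t"
    unfolding gauge_def using cInf_less_iff[OF gauge_nonempty gauge_bdd_below] by auto
  have "(s / t) *\<^sub>R (inverse s *\<^sub>R \<xi>) \<in> \<Omega>"
    using s t scale_mem[of "inverse s *\<^sub>R \<xi>" "s / t"] by simp
  then show "inverse t *\<^sub>R \<xi> \<in> \<Omega>" using s by (simp add: field_simps)
next
  assume m: "inverse t *\<^sub>R \<xi> \<in> \<Omega>"
  have "((\<lambda>s. inverse s *\<^sub>R \<xi>) \<longlongrightarrow> inverse t *\<^sub>R \<xi>) (at_left t)"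
    using t by (intro tendsto_intros) auto
  then have "eventually (\<lambda>s. inverse s *\<^sub>R \<xi> \<in> \<Omega>) (at_left t)"
    using open_domain m by (rule topological_tendstoD)
  moreover have "eventually (\<lambda>s. s \<in> {0<..<t}) (at_left t)"
    using t by (rule eventually_at_left_real)
  ultimately have "eventually (\<lambda>s. inverse s *\<^sub>R \<xi> \<in> \<Omega> \<and> s \<in> {0<..<t}) (at_left t)"
    by eventually_elim auto
  then obtain s where "inverse s *\<^sub>R \<xi> \<in> \<Omega>" "s \<in> {0<..<t}"
    using eventually_happens[of _ "at_left t"] by (auto simp: trivial_limit_at_left_real)
  then show "gauge \<Omega> \<xi> < t"
    unfolding gauge_def using cInf_less_iff[OF gauge_nonempty gauge_bdd_below] by auto
qed

lemma measurable_gauge[measurable]: "gauge \<Omega> \<in> borel_measurable borel"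
proof (rule borel_measurableI_less)
  fix y :: real
  show "{x \<in> space borel. gauge \<Omega> x < y} \<in> sets borel"
  proof (cases "y > 0")
    case True
    then have "{x \<in> space borel. gauge \<Omega> x < y} = (\<lambda>x. inverse y *\<^sub>R x) -` \<Omega>"
      by (auto simp: gauge_less_iff)
    also have "open \<dots>" using open_domain by (intro open_vimage continuous_intros)
    ultimately show ?thesis by simp
  next
    case False
    then have "{x \<in> space borel. gauge \<Omega> x < y} = {}"
      using gauge_nonneg by (auto simp: not_less intro: order_trans)
    then show ?thesis by simp
  qed
qed

lemma measurable_br_multiplier[measurable]: "br_multiplier \<Omega> lam \<in> borel_measurable borel"
proof -
  have [measurable]: "\<Omega> \<in> sets borel" using open_domain by simp
  show ?thesis unfolding br_multiplier_def by (cases "lam > 0") (simp_all, measurable)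
qed

lemma br_multiplier_nonneg: "br_multiplier \<Omega> lam \<xi> \<ge> 0"
  by (simp add: br_multiplier_def)

lemma br_multiplier_le_one: "br_multiplier \<Omega> lam \<xi> \<le> 1"
  using gauge_nonneg[of \<xi>] by (auto simp: br_multiplier_def powr_le1 indicator_def)

lemma br_multiplier_outside: "\<xi> \<notin> \<Omega> \<Longrightarrow> br_multiplier \<Omega> lam \<xi> = 0"
  using gauge_less_iff[of 1 \<xi>] by (auto simp: br_multiplier_def)

text \<open>The last assumption says that the gauge is below \<open>1 - \<delta>\<close>. For
  \<open>lam = 0\<close> the multiplier is an indicator and the bound is
  \<open>\<delta> powr 0 = 1\<close>.\<close>

lemma br_multiplier_ge:
  assumes "0 < \<delta>" "\<delta> < 1" "lam \<ge> 0" "inverse (1 - \<delta>) *\<^sub>R \<xi> \<in> \<Omega>"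
  shows "br_multiplier \<Omega> lam \<xi> \<ge> \<delta> powr lam"
proof -
  have g: "gauge \<Omega> \<xi> < 1 - \<delta>" using assms gauge_less_iff by simp
  show ?thesis
  proof (cases "lam > 0")
    case True
    then show ?thesis using g assms unfolding br_multiplier_def by (simp add: powr_mono2)
  next
    case False
    have "(1 - \<delta>) *\<^sub>R (inverse (1 - \<delta>) *\<^sub>R \<xi>) \<in> \<Omega>" using assms scale_mem[of "inverse (1 - \<delta>) *\<^sub>R \<xi>" "1 - \<delta>"] by simp
    then show ?thesis using False assms by (simp add: br_multiplier_def)
  qed
qed

lemma emeasure_domain_finite: "emeasure lborel \<Omega> < \<infinity>"
  using emeasure_bounded_finite[OF bounded_domain] .

lemma integrable_br_multiplier_mult:
  fixes g :: "R2 \<Rightarrow> complex"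
  assumes [measurable]: "g \<in> borel_measurable borel" and B: "\<And>\<xi>. norm (g \<xi>) \<le> B"
  shows "integrable lborel (\<lambda>\<xi>. complex_of_real (br_multiplier \<Omega> lam \<xi>) * g \<xi>)"
proof (rule Bochner_Integration.integrable_bound)
  have [measurable]: "\<Omega> \<in> sets borel" using open_domain by simp
  show "integrable lborel (\<lambda>\<xi>. B * indicator \<Omega> \<xi>)"
    using emeasure_domain_finite by (intro integrable_mult_right integrable_real_indicator) auto
  have "B \<ge> 0" using B[of 0] norm_ge_zero order_trans by blast
  have "norm (complex_of_real (br_multiplier \<Omega> lam \<xi>) * g \<xi>) \<le> norm (B * indicator \<Omega> \<xi>)" for \<xi>
    using br_multiplier_le_one[of lam \<xi>] br_multiplier_nonneg[of lam \<xi>] br_multiplier_outside[of \<xi> lam] B[of \<xi>] \<open>B \<ge> 0\<close>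
      mult_mono[of "br_multiplier \<Omega> lam \<xi>" 1 "norm (g \<xi>)" B]
    by (cases "\<xi> \<in> \<Omega>") (auto simp: norm_mult)
  then show "AE \<xi> in lborel. norm (complex_of_real (br_multiplier \<Omega> lam \<xi>) * g \<xi>) \<le> norm (B * indicator \<Omega> \<xi>)"
    by auto
qed measurable

text \<open>Plancherel's inequality twice, around a multiplier with values between 0 and 1; the
  inverse transform is a reflected transform. This makes the set whose infimum defines
  \<open>p_crit\<close> nonempty.\<close>

lemma bounded_on_L2: "bounded_on_Lp (BR_op \<Omega> lam) 2"
  unfolding bounded_on_Lp_def
proof (intro exI allI impI, elim conjE)
  fix f :: "R2 \<Rightarrow> complex" assume f: "integrable lborel f"
  have [measurable]: "f \<in> borel_measurable borel" using f by simp
  let ?g = "\<lambda>\<xi>. complex_of_real (br_multiplier \<Omega> lam \<xi>) * fourier2 f \<xi>"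
  have [measurable]: "fourier2 ?g \<in> borel_measurable borel" by measurable
  have "(\<integral>\<^sup>+ x. ennreal (norm (BR_op \<Omega> lam f x) powr 2) \<partial>lborel)
      = (\<integral>\<^sup>+ x. ennreal ((norm (fourier2 ?g (- x)))\<^sup>2) \<partial>lborel)"
    by (simp add: BR_op_def inv_fourier2_eq powr_numeral)
  also have "\<dots> = (\<integral>\<^sup>+ x. ennreal ((norm (fourier2 ?g x))\<^sup>2) \<partial>(distr lborel borel uminus))"
    by (subst nn_integral_distr) auto
  also have "\<dots> = (\<integral>\<^sup>+ x. ennreal ((norm (fourier2 ?g x))\<^sup>2) \<partial>lborel)"
    by (simp add: lborel_distr_reflect)
  also have "\<dots> \<le> (\<integral>\<^sup>+ \<xi>. ennreal ((norm (?g \<xi>))\<^sup>2) \<partial>lborel)"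
    by (intro plancherel_le integrable_br_multiplier_mult[OF _ norm_fourier2_le]) measurable
  also have "\<dots> \<le> (\<integral>\<^sup>+ \<xi>. ennreal ((norm (fourier2 f \<xi>))\<^sup>2) \<partial>lborel)"
    using br_multiplier_nonneg br_multiplier_le_one
    by (intro nn_integral_mono ennreal_leI power_mono) (auto simp: norm_mult intro!: mult_left_le_one_le)
  also have "\<dots> \<le> (\<integral>\<^sup>+ x. ennreal ((norm (f x))\<^sup>2) \<partial>lborel)"
    by (rule plancherel_le[OF f])
  finally show "(\<integral>\<^sup>+ x. ennreal (norm (BR_op \<Omega> lam f x) powr 2) \<partial>lborel)
      \<le> ennreal 1 * (\<integral>\<^sup>+ x. ennreal (norm (f x) powr 2) \<partial>lborel)"
    by (simp add: powr_numeral)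
qed

end

subsection \<open>Sectors in polar-type coordinates\<close>

lemma tendsto_mult_exp_neg:
  assumes d: "d > (0::real)"
  shows "((\<lambda>t. t * exp (- d * t)) \<longlongrightarrow> 0) at_top" "((\<lambda>t. exp (- d * t)) \<longlongrightarrow> 0) at_top"
proof -
  have l: "filterlim (\<lambda>t. d * t) at_top at_top"
    by (rule filterlim_tendsto_pos_mult_at_top[OF tendsto_const d filterlim_ident])
  have "((\<lambda>t. (1 / d) * ((d * t) ^ 1 / exp (d * t))) \<longlongrightarrow> (1 / d) * 0) at_top"
    by (intro tendsto_mult tendsto_const filterlim_compose[OF tendsto_power_div_exp_0 l])
  then show "((\<lambda>t. t * exp (- d * t)) \<longlongrightarrow> 0) at_top"
    using d by (simp add: exp_minus field_simps)
  have "((\<lambda>t. (d * t) ^ 0 / exp (d * t)) \<longlongrightarrow> 0) at_top"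
    by (intro filterlim_compose[OF tendsto_power_div_exp_0 l])
  then show "((\<lambda>t. exp (- d * t)) \<longlongrightarrow> 0) at_top"
    by (simp add: exp_minus field_simps)
qed

lemma nn_integral_mult_exp_neg:
  assumes d: "d > (0::real)"
  shows "(\<integral>\<^sup>+ t. ennreal (t * exp (- d * t)) * indicator {0..} t \<partial>lborel) = ennreal (1 / d\<^sup>2)"
proof -
  let ?F = "\<lambda>t. - (1 / d * (t * exp (- d * t)) + 1 / d\<^sup>2 * exp (- d * t))"
  have "(\<integral>\<^sup>+ t. ennreal (t * exp (- d * t)) * indicator {0..} t \<partial>lborel) = ennreal (0 - ?F 0)"
  proof (rule nn_integral_FTC_atLeast)
    show "DERIV ?F x :> x * exp (- d * x)" for x
      using d by (auto intro!: derivative_eq_intros simp: field_simps power2_eq_square)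
    show "(?F \<longlongrightarrow> 0) at_top"
      by (rule tendsto_eq_intros tendsto_mult_exp_neg[OF d] | simp)+
  qed auto
  then show ?thesis by simp
qed

lemma integrable_mult_exp_neg:
  assumes d: "d > (0::real)"
  shows "integrable lborel (\<lambda>t. indicator {0<..} t * (t * exp (- d * t)))"
proof -
  have "integrable lborel (\<lambda>t. (t * exp (- d * t)) * indicator {0..} t)"
  proof (rule integrableI_nonneg)
    have "(\<integral>\<^sup>+ t. ennreal (t * exp (- d * t) * indicator {0..} t) \<partial>lborel)
        = (\<integral>\<^sup>+ t. ennreal (t * exp (- d * t)) * indicator {0..} t \<partial>lborel)"
      by (intro nn_integral_cong) (auto simp: indicator_def)
    then show "(\<integral>\<^sup>+ t. ennreal (t * exp (- d * t) * indicator {0..} t) \<partial>lborel) < \<infinity>"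
      unfolding nn_integral_mult_exp_neg[OF d] by simp
  qed (auto simp: indicator_def)
  moreover have "(\<lambda>t. (t * exp (- d * t)) * indicator {0..} t) = (\<lambda>t. indicator {0<..} t * (t * exp (- d * t)))"
    by (auto simp: indicator_def fun_eq_iff less_le)
  ultimately show ?thesis by simp
qed

text \<open>The Laplace transform of \<open>t\<close> at \<open>z = d + i c\<close>. The
  antiderivative \<open>F\<close> vanishes at infinity because \<open>d > 0\<close>, and
  \<open>F 0\<close> is minus the claimed value.\<close>

lemma laplace_identity_complex:
  assumes d: "d > (0::real)"
  shows "(LINT t|lborel. complex_of_real (indicator {0<..} t * (t * exp (- d * t))) * cis (- c * t))
           = 1 / (Complex d c)\<^sup>2"
proof -
  define z where "z = Complex d c"
  have z: "z \<noteq> 0" using d by (auto simp: z_def complex_eq_iff)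
  define F where "F t = - ((complex_of_real t / z + 1 / z\<^sup>2) * exp (- z * complex_of_real t))" for t
  let ?f = "\<lambda>t. complex_of_real t * exp (- z * complex_of_real t)"
  have ez: "exp (- z * complex_of_real t) = complex_of_real (exp (- d * t)) * cis (- c * t)" for t
    by (simp add: exp_eq_polar z_def)
  have f_eq: "complex_of_real (indicator {0<..} t * (t * exp (- d * t))) * cis (- c * t)
      = indicator {0<..} t *\<^sub>R ?f t" for t
    unfolding ez by (simp add: indicator_def)
  have "(LBINT x=ereal 0..\<infinity>. ?f x) = 0 - F 0"
  proof (rule interval_integral_FTC_integrable)
    have "(F has_vector_derivative ?f x) (at x)" for x
    proof -
      have "((\<lambda>w. - ((w / z + 1 / z\<^sup>2) * exp (- z * w))) has_field_derivative ?f x) (at (complex_of_real x))"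
        using z by (auto intro!: derivative_eq_intros simp: field_simps power2_eq_square)
      then have "((\<lambda>w. - ((w / z + 1 / z\<^sup>2) * exp (- z * w))) \<circ> complex_of_real has_vector_derivative 1 * ?f x) (at x)"
        by (intro field_vector_diff_chain_at) (auto intro!: derivative_eq_intros)
      then show ?thesis by (simp add: F_def[abs_def] o_def)
    qed
    then show "(F has_vector_derivative ?f x) (at x)" for x .
    show "isCont ?f x" for x by (intro continuous_intros)
    have "integrable lborel (\<lambda>t. complex_of_real (indicator {0<..} t * (t * exp (- d * t))) * cis (- c * t))"
      using integrable_mult_exp_neg[OF d] by (intro integrable_mult_cis) (simp_all del: of_real_mult)
    then show "set_integrable lborel (einterval (ereal 0) \<infinity>) ?f"
      unfolding set_integrable_def f_eq by (simp add: einterval_eq)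
    have "(F \<longlongrightarrow> F 0) (at_right 0)"
      unfolding F_def by (intro tendsto_intros z) (use z in auto)
    then show "((F \<circ> real_of_ereal) \<longlongrightarrow> F 0) (at_right (ereal 0))"
      by (simp only: ereal_tendsto_simps)
    have "(F \<longlongrightarrow> 0) at_top"
    proof (rule tendsto_norm_zero_cancel, rule tendsto_sandwich[where f = "\<lambda>_. 0"])
      have "norm (F t) \<le> 1 / norm z * (t * exp (- d * t)) + 1 / (norm z)\<^sup>2 * exp (- d * t)" if "t > 0" for t
      proof -
        have "norm (F t) \<le> (norm (complex_of_real t / z) + norm (1 / z\<^sup>2)) * exp (- d * t)"
          unfolding F_def norm_minus_cancel norm_mult ez
          by (intro mult_mono norm_triangle_ineq) (auto simp: norm_mult)
        then show ?thesis using that by (simp add: norm_divide norm_power field_simps)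
      qed
      then show "eventually (\<lambda>t. norm (F t) \<le> 1 / norm z * (t * exp (- d * t)) + 1 / (norm z)\<^sup>2 * exp (- d * t)) at_top"
        by (intro eventually_mono[OF eventually_gt_at_top[of 0]])
      show "((\<lambda>t. 1 / norm z * (t * exp (- d * t)) + 1 / (norm z)\<^sup>2 * exp (- d * t)) \<longlongrightarrow> 0) at_top"
        by (rule tendsto_eq_intros tendsto_mult_exp_neg[OF d] | simp)+
    qed auto
    then show "((F \<circ> real_of_ereal) \<longlongrightarrow> 0) (at_left \<infinity>)"
      by (simp only: ereal_tendsto_simps)
  qed auto
  moreover have "(LBINT x=ereal 0..\<infinity>. ?f x) = (LINT t|lborel. indicator {0<..} t *\<^sub>R ?f t)"
    by (simp add: interval_lebesgue_integral_def set_lebesgue_integral_def einterval_eq)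
  ultimately show ?thesis unfolding f_eq by (simp add: F_def z_def)
qed

text \<open>The open-ended cone over the segment of all \<open>a + v *\<^sub>R b\<close> with
  \<bar>v\<bar> \<le> 1, without its vertex.\<close>

definition sector :: "R2 \<Rightarrow> R2 \<Rightarrow> R2 set" where
  "sector a b = {x. x \<bullet> a > 0 \<and> \<bar>x \<bullet> b\<bar> \<le> x \<bullet> a}"

lemma sets_sector[measurable]: "sector a b \<in> sets borel"
  unfolding sector_def by measurable

text \<open>For a fixed first coordinate \<open>t > 0\<close> the substitution
  \<open>w = t * v\<close> contributes the Jacobian \<open>t\<close> and turns the range
  \<bar>w\<bar> \<le> t into \<bar>v\<bar> \<le> 1.\<close>

lemma nn_integral_sector:
  assumes fr: "signed_frame a b" and [measurable]: "F \<in> borel_measurable borel"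
  shows "(\<integral>\<^sup>+ x. indicator (sector a b) x * F x \<partial>lborel)
       = (\<integral>\<^sup>+ (t, v). ennreal (indicator {0<..} t * t) * indicator {-1..1} v * F (t *\<^sub>R (a + v *\<^sub>R b)) \<partial>(lborel \<Otimes>\<^sub>M lborel))"
proof -
  let ?I = "\<lambda>t w. indicator (sector a b) (t *\<^sub>R a + w *\<^sub>R b) * F (t *\<^sub>R a + w *\<^sub>R b)"
  note in_frame = signed_frame_inner[OF fr]
  have "(\<integral>\<^sup>+ x. indicator (sector a b) x * F x \<partial>lborel)
      = (\<integral>\<^sup>+ x. indicator (sector a b) x * F x \<partial>(distr (lborel \<Otimes>\<^sub>M lborel) borel (\<lambda>(s, t). s *\<^sub>R a + t *\<^sub>R b)))"
    by (rule arg_cong[OF lborel_signed_frame[OF fr]])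
  also have "\<dots> = (\<integral>\<^sup>+ z. ?I (fst z) (snd z) \<partial>(lborel \<Otimes>\<^sub>M lborel))"
    by (subst nn_integral_distr) (auto simp: case_prod_beta')
  also have "\<dots> = (\<integral>\<^sup>+ t. \<integral>\<^sup>+ w. ?I t w \<partial>lborel \<partial>lborel)"
    by (subst lborel.nn_integral_fst[symmetric]) auto
  also have "\<dots> = (\<integral>\<^sup>+ t. \<integral>\<^sup>+ v. ennreal (indicator {0<..} t * t) * indicator {-1..1} v * F (t *\<^sub>R (a + v *\<^sub>R b)) \<partial>lborel \<partial>lborel)"
  proof (rule nn_integral_cong)
    fix t :: real
    show "(\<integral>\<^sup>+ w. ?I t w \<partial>lborel)
        = (\<integral>\<^sup>+ v. ennreal (indicator {0<..} t * t) * indicator {-1..1} v * F (t *\<^sub>R (a + v *\<^sub>R b)) \<partial>lborel)"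
    proof (cases "t > 0")
      case True
      have "(\<integral>\<^sup>+ w. ?I t w \<partial>lborel) = ennreal \<bar>t\<bar> * (\<integral>\<^sup>+ v. ?I t (0 + t * v) \<partial>lborel)"
        using True by (intro nn_integral_real_affine) auto
      also have "\<dots> = (\<integral>\<^sup>+ v. ennreal \<bar>t\<bar> * ?I t (0 + t * v) \<partial>lborel)"
        by (rule nn_integral_cmult[symmetric]) measurable
      also have "\<dots> = (\<integral>\<^sup>+ v. ennreal (indicator {0<..} t * t) * indicator {-1..1} v * F (t *\<^sub>R (a + v *\<^sub>R b)) \<partial>lborel)"
      proof (rule nn_integral_cong)
        fix v :: real
        have "t *\<^sub>R a + (0 + t * v) *\<^sub>R b \<in> sector a b \<longleftrightarrow> v \<in> {-1..1}"
          using True in_frame mult_le_cancel_left_pos[of t "\<bar>v\<bar>" 1]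
          by (auto simp: sector_def inner_add_left abs_mult)
        then show "ennreal \<bar>t\<bar> * ?I t (0 + t * v)
           = ennreal (indicator {0<..} t * t) * indicator {-1..1} v * F (t *\<^sub>R (a + v *\<^sub>R b))"
          using True by (auto simp: indicator_def scaleR_add_right)
      qed
      finally show ?thesis .
    next
      case False
      then have "t *\<^sub>R a + w *\<^sub>R b \<notin> sector a b" for w
        using in_frame by (auto simp: sector_def inner_add_left)
      then show ?thesis using False by simp
    qed
  qed
  also have "\<dots> = (\<integral>\<^sup>+ (t, v). ennreal (indicator {0<..} t * t) * indicator {-1..1} v * F (t *\<^sub>R (a + v *\<^sub>R b)) \<partial>(lborel \<Otimes>\<^sub>M lborel))"
    by (subst lborel.nn_integral_fst[symmetric]) (auto simp: case_prod_beta')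
  finally show ?thesis .
qed

text \<open>The preceding formula tested on indicators. As an identity of measures it also
  transports complex integrals.\<close>

lemma sector_measure:
  assumes fr: "signed_frame a b"
  shows "density lborel (indicator (sector a b))
     = distr (density (lborel \<Otimes>\<^sub>M lborel) (\<lambda>(t, v). ennreal (indicator {0<..} t * t) * indicator {-1..1} v))
         borel (\<lambda>(t, v). t *\<^sub>R (a + v *\<^sub>R b))" (is "_ = distr (density _ ?w) borel ?m")
proof (rule measure_eqI)
  have m[measurable]: "?m \<in> lborel \<Otimes>\<^sub>M lborel \<rightarrow>\<^sub>M borel" by (simp add: case_prod_beta')
  fix A assume "A \<in> sets (density lborel (indicator (sector a b)))"
  then have [measurable]: "A \<in> sets borel" by simp
  have "emeasure (density lborel (indicator (sector a b))) A = (\<integral>\<^sup>+ x. indicator (sector a b) x * indicator A x \<partial>lborel)"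
    by (simp add: emeasure_density)
  also have "\<dots> = (\<integral>\<^sup>+ z. ?w z * indicator A (?m z) \<partial>(lborel \<Otimes>\<^sub>M lborel))"
    by (subst nn_integral_sector[OF fr]) (auto simp: case_prod_beta')
  also have "\<dots> = (\<integral>\<^sup>+ z. indicator A (?m z) \<partial>(density (lborel \<Otimes>\<^sub>M lborel) ?w))"
    by (rule nn_integral_density[symmetric]) (auto simp: case_prod_beta')
  also have "\<dots> = (\<integral>\<^sup>+ x. indicator A x \<partial>(distr (density (lborel \<Otimes>\<^sub>M lborel) ?w) borel ?m))"
    by (rule nn_integral_distr[symmetric]) auto
  also have "\<dots> = emeasure (distr (density (lborel \<Otimes>\<^sub>M lborel) ?w) borel ?m) A"
    by simp
  finally show "emeasure (density lborel (indicator (sector a b))) A = \<dots>" .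
qed simp

lemma integral_sector:
  fixes F :: "R2 \<Rightarrow> complex"
  assumes fr: "signed_frame a b" and [measurable]: "F \<in> borel_measurable borel"
  shows "(LINT x|lborel. complex_of_real (indicator (sector a b) x) * F x)
       = integral\<^sup>L (lborel \<Otimes>\<^sub>M lborel) (\<lambda>(t, v). complex_of_real (indicator {0<..} t * t * indicator {-1..1} v) * F (t *\<^sub>R (a + v *\<^sub>R b)))"
proof -
  let ?m = "\<lambda>(t::real, v::real). t *\<^sub>R (a + v *\<^sub>R b)"
  let ?w = "\<lambda>(t::real, v::real). indicator {0<..} t * t * indicator {-1..1} v :: real"
  have m[measurable]: "?m \<in> lborel \<Otimes>\<^sub>M lborel \<rightarrow>\<^sub>M borel" by (simp add: case_prod_beta')
  have w: "(\<lambda>(t, v). ennreal (indicator {0<..} t * t) * indicator {-1..1} v) = (\<lambda>z. ennreal (?w z))"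
    by (auto simp: fun_eq_iff indicator_def)
  have "(LINT x|lborel. complex_of_real (indicator (sector a b) x) * F x)
      = (LINT x|density lborel (\<lambda>x. ennreal (indicator (sector a b) x)). F x)"
    by (subst integral_density) (auto simp: scaleR_conv_of_real)
  also have "density lborel (\<lambda>x. ennreal (indicator (sector a b) x)) = density lborel (indicator (sector a b))"
    by (simp add: ennreal_indicator)
  also have "(LINT x|density lborel (indicator (sector a b)). F x)
     = (LINT z|density (lborel \<Otimes>\<^sub>M lborel) (\<lambda>z. ennreal (?w z)). F (?m z))"
    unfolding sector_measure[OF fr] w by (subst integral_distr) auto
  also have "\<dots> = (LINT z|(lborel \<Otimes>\<^sub>M lborel). ?w z *\<^sub>R F (?m z))"
    by (subst integral_density) (auto simp: case_prod_beta' indicator_def)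
  also have "\<dots> = integral\<^sup>L (lborel \<Otimes>\<^sub>M lborel) (\<lambda>(t, v). complex_of_real (indicator {0<..} t * t * indicator {-1..1} v) * F (t *\<^sub>R (a + v *\<^sub>R b)))"
    by (intro Bochner_Integration.integral_cong refl) (auto simp: scaleR_conv_of_real)
  finally show ?thesis .
qed

subsection \<open>The support function and slabs near the boundary\<close>

lemma measure_lborel_box_R2:
  "measure lebesgue (box l u :: R2 set) = (if l $ 1 \<le> u $ 1 \<and> l $ 2 \<le> u $ 2 then (u $ 1 - l $ 1) * (u $ 2 - l $ 2) else 0)"
  by (simp add: measure_lborel_box_eq Basis_R2 axis_neq_R2 inner_axis)

context convex_domain
begin

text \<open>The constants below depend on the domain only through \<open>inr\<close> and
  \<open>outr\<close>, which bound the support function on unit vectors from below and from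
  above.\<close>

definition inr where "inr = (SOME r. r > 0 \<and> cball 0 r \<subseteq> \<Omega>)"

definition outr where "outr = (SOME r. r > 0 \<and> closure \<Omega> \<subseteq> cball 0 r)"

lemma inr: "inr > 0" "cball 0 inr \<subseteq> \<Omega>"
proof -
  have "\<exists>r. r > 0 \<and> cball 0 r \<subseteq> \<Omega>" using open_domain zero open_contains_cball by blast
  from someI_ex[OF this] show "inr > 0" "cball 0 inr \<subseteq> \<Omega>" by (simp_all add: inr_def)
qed

lemma outr: "outr > 0" "\<eta> \<in> closure \<Omega> \<Longrightarrow> norm \<eta> \<le> outr"
proof -
  have "bounded (closure \<Omega>)" using bounded_domain by (rule bounded_closure)
  then have "\<exists>r. r > 0 \<and> closure \<Omega> \<subseteq> cball 0 r"
    by (auto simp: bounded_pos subset_iff)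
  from someI_ex[OF this] show "outr > 0" "\<eta> \<in> closure \<Omega> \<Longrightarrow> norm \<eta> \<le> outr"
    by (auto simp: outr_def subset_iff)
qed

lemma compact_closure_domain: "compact (closure \<Omega>)"
  using bounded_domain by (simp add: compact_closure)

lemma zero_closure: "0 \<in> closure \<Omega>"
  using zero closure_subset by blast

lemma scale_closure:
  assumes x: "x \<in> closure \<Omega>" and t: "0 \<le> t" "t < 1"
  shows "t *\<^sub>R x \<in> \<Omega>"
proof -
  have "x - (1 - t) *\<^sub>R (x - 0) \<in> interior \<Omega>"
    using zero open_domain t by (intro mem_interior_closure_convex_shrink[OF convex _ x]) (auto simp: interior_open)
  then show ?thesis using interior_subset by (auto simp: algebra_simps)
qed

text \<open>The supremum runs over the closure so that it is attained.\<close>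

definition supp :: "R2 \<Rightarrow> real" where "supp x = (SUP \<eta>\<in>closure \<Omega>. x \<bullet> \<eta>)"

lemma supp_attained: "\<exists>\<eta>\<in>closure \<Omega>. x \<bullet> \<eta> = supp x"
  and supp_ge: "\<eta> \<in> closure \<Omega> \<Longrightarrow> x \<bullet> \<eta> \<le> supp x"
proof -
  have "\<exists>\<eta>\<in>closure \<Omega>. \<forall>\<zeta>\<in>closure \<Omega>. x \<bullet> \<zeta> \<le> x \<bullet> \<eta>"
    using zero_closure by (intro continuous_attains_sup[OF compact_closure_domain]) (auto intro!: continuous_intros)
  then obtain \<eta> where \<eta>: "\<eta> \<in> closure \<Omega>" "\<And>\<zeta>. \<zeta> \<in> closure \<Omega> \<Longrightarrow> x \<bullet> \<zeta> \<le> x \<bullet> \<eta>"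
    by blast
  then have "supp x = x \<bullet> \<eta>" unfolding supp_def by (intro cSup_eq_maximum) auto
  then show "\<exists>\<eta>\<in>closure \<Omega>. x \<bullet> \<eta> = supp x" "\<eta> \<in> closure \<Omega> \<Longrightarrow> x \<bullet> \<eta> \<le> supp x" for \<eta>
    using \<eta> by auto
qed

lemma supp_leI: "(\<And>\<eta>. \<eta> \<in> closure \<Omega> \<Longrightarrow> x \<bullet> \<eta> \<le> c) \<Longrightarrow> supp x \<le> c"
  using supp_attained[of x] by metis

lemma supp_scale: "t \<ge> 0 \<Longrightarrow> supp (t *\<^sub>R x) = t * supp x"
proof (rule antisym)
  assume t: "t \<ge> 0"
  show "supp (t *\<^sub>R x) \<le> t * supp x"
    using t supp_ge by (intro supp_leI) (simp add: mult_left_mono)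
  show "t * supp x \<le> supp (t *\<^sub>R x)"
    using supp_attained[of x] supp_ge[of _ "t *\<^sub>R x"] by (metis inner_scaleR_left)
qed

lemma supp_lower: "inr * norm x \<le> supp x"
proof (cases "x = 0")
  case True
  then show ?thesis using supp_ge[OF zero_closure, of 0] by simp
next
  case False
  have "(inr / norm x) *\<^sub>R x \<in> closure \<Omega>"
    by (rule subsetD[OF closure_subset], rule subsetD[OF inr(2)]) (use inr(1) False in simp)
  from supp_ge[OF this, of x] show ?thesis
    using False by (simp add: power2_norm_eq_inner[symmetric] power2_eq_square)
qed

lemma supp_upper: "supp x \<le> outr * norm x"
proof (rule supp_leI)
  fix \<eta> assume "\<eta> \<in> closure \<Omega>"
  then have "norm x * norm \<eta> \<le> norm x * outr" by (intro mult_left_mono outr(2)) auto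
  then show "x \<bullet> \<eta> \<le> outr * norm x"
    using norm_cauchy_schwarz[of x \<eta>] by (simp add: mult.commute)
qed

lemma supp_lipschitz: "\<bar>supp x - supp y\<bar> \<le> outr * norm (x - y)"
proof -
  have *: "supp x \<le> supp y + outr * norm (x - y)" for x y
  proof (rule supp_leI)
    fix \<eta> assume \<eta>: "\<eta> \<in> closure \<Omega>"
    have "(x - y) \<bullet> \<eta> \<le> norm (x - y) * norm \<eta>" by (rule norm_cauchy_schwarz)
    also have "\<dots> \<le> outr * norm (x - y)" using outr(2)[OF \<eta>] by (simp add: mult.commute mult_right_mono)
    finally show "x \<bullet> \<eta> \<le> supp y + outr * norm (x - y)"
      using supp_ge[OF \<eta>, of y] by (simp add: inner_diff_left)
  qed
  show ?thesis using *[of x y] *[of y x] by (simp add: norm_minus_commute abs_le_iff)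
qed

lemma continuous_supp: "continuous_on UNIV supp"
proof (rule continuous_onI)
  fix x :: R2 and e :: real assume "e > 0"
  show "\<exists>d>0. \<forall>x'\<in>UNIV. dist x' x < d \<longrightarrow> dist (supp x') (supp x) \<le> e"
  proof (intro exI[of _ "e / outr"] conjI ballI impI)
    fix x' assume "dist x' x < e / outr"
    then have "outr * norm (x' - x) \<le> e" using outr by (simp add: dist_norm field_simps)
    then show "dist (supp x') (supp x) \<le> e" using supp_lipschitz[of x' x] by (simp add: dist_real_def)
  qed (use \<open>e > 0\<close> outr in simp)
qed

lemma measurable_supp[measurable]: "supp \<in> borel_measurable borel"
  using continuous_supp by (rule borel_measurable_continuous_onI)

end

section \<open>The support function and its contact points in one chart of directions\<close>

locale convex_chart = convex_domain +
  fixes a b :: R2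
  assumes frame: "signed_frame a b"
begin

definition h :: "real \<Rightarrow> real" where "h v = supp (a + v *\<^sub>R b)"

text \<open>The contact points of the supporting line with normal \<open>a + v *\<^sub>R b\<close>.
  A flat piece of the boundary yields many of them; \<open>touch\<close> fixes one, while the
  covering statements have to handle all.\<close>

definition maximizer :: "R2 \<Rightarrow> real \<Rightarrow> bool" where
  "maximizer x v \<longleftrightarrow> x \<in> closure \<Omega> \<and> x \<bullet> (a + v *\<^sub>R b) = h v"

definition touch :: "real \<Rightarrow> R2" where "touch v = (SOME x. maximizer x v)"

text \<open>
  \<open>gap u v\<close> is the Bregman divergence of the convex function \<open>h\<close>, with \<open>touch u \<bullet> b\<close> as subgradient at \<open>u\<close>.
\<close>

definition gap :: "real \<Rightarrow> real \<Rightarrow> real" where "gap u v = h v - touch u \<bullet> (a + v *\<^sub>R b)"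

lemma maximizer_touch: "maximizer (touch v) v"
proof -
  have "\<exists>x. maximizer x v"
    using supp_attained[of "a + v *\<^sub>R b"] by (auto simp: maximizer_def h_def inner_commute)
  then show ?thesis unfolding touch_def by (rule someI_ex)
qed

lemma touch_closure: "touch v \<in> closure \<Omega>" and touch_inner: "touch v \<bullet> (a + v *\<^sub>R b) = h v"
  using maximizer_touch by (auto simp: maximizer_def)

lemma h_ge: "x \<in> closure \<Omega> \<Longrightarrow> x \<bullet> (a + v *\<^sub>R b) \<le> h v"
  using supp_ge[of x "a + v *\<^sub>R b"] by (simp add: h_def inner_commute)

lemma norm_direction: "norm (a + v *\<^sub>R b) \<ge> 1" "\<bar>v\<bar> \<le> 1 \<Longrightarrow> norm (a + v *\<^sub>R b) \<le> 2"
proof -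
  have n: "norm a = 1" "norm b = 1" using signed_frame_inner[OF frame] by (simp_all add: norm_eq_sqrt_inner)
  have "(a + v *\<^sub>R b) \<bullet> a \<le> norm (a + v *\<^sub>R b) * norm a" by (rule norm_cauchy_schwarz)
  then show "norm (a + v *\<^sub>R b) \<ge> 1" using n signed_frame_inner[OF frame] by (simp add: inner_add_left)
  assume "\<bar>v\<bar> \<le> 1"
  then show "norm (a + v *\<^sub>R b) \<le> 2" using norm_triangle_ineq[of a "v *\<^sub>R b"] n by simp
qed

lemma h_lower: "inr \<le> h v"
proof -
  have "inr * 1 \<le> inr * norm (a + v *\<^sub>R b)" using inr norm_direction by (intro mult_left_mono) auto
  then show ?thesis using supp_lower[of "a + v *\<^sub>R b"] unfolding h_def by linarith
qed

lemma h_upper: "\<bar>v\<bar> \<le> 1 \<Longrightarrow> h v \<le> 2 * outr"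
proof -
  assume "\<bar>v\<bar> \<le> 1"
  then have "outr * norm (a + v *\<^sub>R b) \<le> outr * 2" using outr norm_direction by (intro mult_left_mono) auto
  then show ?thesis using supp_upper[of "a + v *\<^sub>R b"] unfolding h_def by linarith
qed

lemma continuous_h: "continuous_on A h"
  unfolding h_def by (rule continuous_on_compose2[OF continuous_supp]) (auto intro!: continuous_intros)

lemma measurable_h[measurable]: "h \<in> borel_measurable borel"
  using continuous_h by (rule borel_measurable_continuous_onI)

lemma continuous_gap: "continuous_on A (gap u)"
  unfolding gap_def by (intro continuous_intros continuous_h)

lemma gap_nonneg: "gap u v \<ge> 0"
  using h_ge[OF touch_closure, of u v] by (simp add: gap_def)

lemma gap_self: "gap u u = 0"
  by (simp add: gap_def touch_inner)

text \<open>Monotonicity of subgradients: add the two optimality inequalities.\<close>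

lemma maximizer_mono:
  assumes "maximizer x u" "maximizer y v" "u < v"
  shows "x \<bullet> b \<le> y \<bullet> b"
proof -
  have "x \<bullet> (a + v *\<^sub>R b) \<le> y \<bullet> (a + v *\<^sub>R b)" "y \<bullet> (a + u *\<^sub>R b) \<le> x \<bullet> (a + u *\<^sub>R b)"
    using assms h_ge[of x v] h_ge[of y u] by (auto simp: maximizer_def)
  then have "0 \<le> (v - u) * (y \<bullet> b - x \<bullet> b)" by (simp add: inner_add_right algebra_simps)
  then show ?thesis using assms(3) by (simp add: zero_le_mult_iff)
qed

lemma touch_mono: "u \<le> v \<Longrightarrow> touch u \<bullet> b \<le> touch v \<bullet> b"
  using maximizer_mono[OF maximizer_touch maximizer_touch, of u v] by (cases "u = v") auto

text \<open>\<open>touch v \<bullet> b\<close> is a subgradient of \<open>h\<close> at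
  \<open>v\<close>, and \<open>gap u\<close> differs from \<open>h\<close> by an affine function of
  slope \<open>touch u \<bullet> b\<close>. It yields monotonicity of \<open>gap u\<close> to the
  right of \<open>u\<close>, and with \<open>w = v - e\<close> it bounds difference quotients by
  slope increments.\<close>

lemma gap_diff_le: "gap u v - gap u w \<le> (v - w) * (touch v \<bullet> b - touch u \<bullet> b)"
proof -
  have "touch v \<bullet> (a + w *\<^sub>R b) \<le> h w" by (rule h_ge[OF touch_closure])
  then show ?thesis using touch_inner[of v] by (simp add: gap_def inner_add_right algebra_simps)
qed

lemma gap_mono: "u \<le> v \<Longrightarrow> v \<le> w \<Longrightarrow> gap u v \<le> gap u w"
  using gap_diff_le[of u v w] touch_mono[of u v] mult_nonpos_nonneg[of "v - w" "touch v \<bullet> b - touch u \<bullet> b"]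
  by simp

text \<open>
  Points touched between \<open>v\<close> and \<open>w\<close> are close to the supporting line at the right end point \<open>w\<close>; they may
  be far from the one at \<open>v\<close>.
\<close>

lemma gap_maximizer_le:
  assumes "maximizer x u" "v < u" "u \<le> w"
  shows "h w - x \<bullet> (a + w *\<^sub>R b) \<le> gap v w"
proof -
  have b: "touch v \<bullet> b \<le> x \<bullet> b" using maximizer_mono[OF maximizer_touch assms(1,2)] .
  have "touch v \<bullet> (a + u *\<^sub>R b) \<le> x \<bullet> (a + u *\<^sub>R b)"
    using assms h_ge[OF touch_closure, of v u] by (simp add: maximizer_def)
  moreover have "(w - u) * (touch v \<bullet> b) \<le> (w - u) * (x \<bullet> b)"
    using b assms by (intro mult_left_mono) auto
  ultimately show ?thesis by (simp add: gap_def inner_add_right algebra_simps)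
qed

text \<open>
  Shrinking by \<open>1 - \<delta>\<close> forces the multiplier to be at least \<open>\<delta> powr lam\<close>, and at the same time pushes the
  points to a depth at least \<open>inr * \<delta>\<close>, where the oscillatory kernel is large.
\<close>

definition slab :: "real \<Rightarrow> real \<Rightarrow> R2 set" where
  "slab \<delta> v = {\<eta>. inverse (1 - \<delta>) *\<^sub>R \<eta> \<in> \<Omega> \<and> inr * \<delta> \<le> h v - \<eta> \<bullet> (a + v *\<^sub>R b)
                 \<and> h v - \<eta> \<bullet> (a + v *\<^sub>R b) \<le> (4 * outr + 1) * \<delta>}"

lemma sets_slab[measurable]: "slab \<delta> v \<in> sets borel"
proof -
  have [measurable]: "\<Omega> \<in> sets borel" using open_domain by simp
  show ?thesis unfolding slab_def by measurable
qed

text \<open>The point is \<sigma> times the convex combination of the two contact points with weight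
  \<open>t / \<sigma>\<close>, and \<sigma> is below \<open>1 - \<delta>\<close>, so it lies in the
  shrunken domain. Its depth below the line at \<open>v\<close> is an explicit combination of
  \<open>h v\<close> and \<open>gap u v\<close>.\<close>

lemma slab_parallelogram:
  assumes \<delta>: "0 < \<delta>" "\<delta> \<le> 1/4" and v: "\<bar>v\<bar> \<le> 1" and gap: "gap u v \<le> \<delta>"
    and \<sigma>: "1 - 2 * \<delta> < \<sigma>" "\<sigma> < 1 - \<delta>" and t: "0 < t" "t < 1/2"
  shows "\<sigma> *\<^sub>R touch u + t *\<^sub>R (touch v - touch u) \<in> slab \<delta> v"
proof -
  define \<eta> where "\<eta> = \<sigma> *\<^sub>R touch u + t *\<^sub>R (touch v - touch u)"
  have \<sigma>0: "\<sigma> > 1/2" using \<sigma> \<delta> by simp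
  have "(1 - t / \<sigma>) *\<^sub>R touch u + (t / \<sigma>) *\<^sub>R touch v \<in> closure \<Omega>"
    using \<sigma>0 t by (intro convexD_alt convex_closure convex touch_closure) (auto simp: field_simps)
  then have "(\<sigma> / (1 - \<delta>)) *\<^sub>R ((1 - t / \<sigma>) *\<^sub>R touch u + (t / \<sigma>) *\<^sub>R touch v) \<in> \<Omega>"
    using \<sigma>0 \<sigma> \<delta> by (intro scale_closure) (auto simp: field_simps)
  moreover have "(\<sigma> / (1 - \<delta>)) *\<^sub>R ((1 - t / \<sigma>) *\<^sub>R touch u + (t / \<sigma>) *\<^sub>R touch v) = inverse (1 - \<delta>) *\<^sub>R \<eta>"
  proof -
    have "(\<sigma> / (1 - \<delta>)) *\<^sub>R ((1 - t / \<sigma>) *\<^sub>R touch u + (t / \<sigma>) *\<^sub>R touch v)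
       = inverse (1 - \<delta>) *\<^sub>R (\<sigma> *\<^sub>R ((1 - t / \<sigma>) *\<^sub>R touch u + (t / \<sigma>) *\<^sub>R touch v))"
      by (simp only: scaleR_scaleR divide_inverse mult.commute)
    also have "\<sigma> *\<^sub>R ((1 - t / \<sigma>) *\<^sub>R touch u + (t / \<sigma>) *\<^sub>R touch v) = \<eta>"
      using \<sigma>0 by (simp add: \<eta>_def scaleR_add_right scaleR_diff_left scaleR_diff_right right_diff_distrib)
    finally show ?thesis .
  qed
  ultimately have 1: "inverse (1 - \<delta>) *\<^sub>R \<eta> \<in> \<Omega>" by simp
  have 2: "h v - \<eta> \<bullet> (a + v *\<^sub>R b) = (1 - \<sigma>) * h v + (\<sigma> - t) * gap u v"
  proof -
    define y where "y = a + v *\<^sub>R b"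
    have "touch v \<bullet> y = h v" using touch_inner by (simp add: y_def)
    then show ?thesis unfolding gap_def \<eta>_def y_def[symmetric]
      by (simp add: inner_add_left inner_diff_left algebra_simps)
  qed
  \<comment> \<open>These bounds are the source of the constants \<open>inr\<close> and
    \<open>4 * outr + 1\<close> in \<open>slab\<close>: \<open>h v\<close> lies between
    \<open>inr\<close> and \<open>2 * outr\<close>, and \<open>1 - \<sigma>\<close> between \<delta>
    and \<open>2 * \<delta>\<close>.\<close>
  have "inr * \<delta> \<le> h v * (1 - \<sigma>)"
    using h_lower[of v] inr \<sigma> \<delta> by (intro mult_mono) auto
  moreover have "0 \<le> (\<sigma> - t) * gap u v" using \<sigma>0 t gap_nonneg by simp
  moreover have "(1 - \<sigma>) * h v \<le> (2 * \<delta>) * (2 * outr)"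
    using h_upper[OF v] h_lower[of v] inr \<sigma> \<delta> by (intro mult_mono) auto
  moreover have "(\<sigma> - t) * gap u v \<le> 1 * \<delta>"
    using \<sigma>0 t \<sigma> \<delta> gap gap_nonneg by (intro mult_mono) auto
  ultimately show ?thesis
    using 1 unfolding \<eta>_def[symmetric] slab_def mem_Collect_eq 2
    by (intro conjI) (simp_all add: mult.commute distrib_left)
qed

text \<open>A frame is an orthonormal basis of either orientation, so it changes a determinant at
  most by its sign.\<close>

lemma abs_cross_signed_frame:
  "\<bar>x $ 1 * y $ 2 - y $ 1 * x $ 2\<bar> = \<bar>(x \<bullet> a) * (y \<bullet> b) - (x \<bullet> b) * (y \<bullet> a)\<bar>"
  using frame unfolding signed_frame_def by (auto simp: inner_axis abs_minus_commute algebra_simps)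

text \<open>The slab contains the linear image of a rectangle of area \<open>\<delta> / 2\<close>.
  The determinant is essentially the height \<open>h v\<close> times the slope increment from
  \<open>u\<close> to \<open>v\<close>; the term with \<open>outr\<close> is the loss because the
  contact point at \<open>u\<close> does not lie on the line at \<open>v\<close>.\<close>

lemma emeasure_slab_ge:
  assumes \<delta>: "0 < \<delta>" "\<delta> \<le> 1/4" "\<delta> \<le> inr / 2" and v: "\<bar>v\<bar> \<le> 1" and uv: "u \<le> v" and gap: "gap u v \<le> \<delta>"
  shows "emeasure lborel (slab \<delta> v)
    \<ge> ennreal (\<delta> / 2 * (inr / 2 * (touch v \<bullet> b - touch u \<bullet> b) - outr * gap u v))"
proof -
  define q p where "q = touch u" and "p = touch v - touch u"
  define A where "A x = x $ 1 *\<^sub>R q + x $ 2 *\<^sub>R p" for x :: R2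
  let ?B = "box (vector [1 - 2 * \<delta>, 0]) (vector [1 - \<delta>, 1/2]) :: R2 set"
  have lin: "linear A" unfolding A_def by (rule linearI) (simp_all add: algebra_simps)
  have sub: "A ` ?B \<subseteq> slab \<delta> v"
    using slab_parallelogram[OF \<delta>(1,2) v gap]
    by (auto simp: A_def q_def p_def mem_box_cart forall_2)
  have Bm: "measure lebesgue ?B = \<delta> / 2"
    unfolding measure_lborel_box_R2 using \<delta> by simp
  have det: "det (matrix A) = q $ 1 * p $ 2 - p $ 1 * q $ 2"
    by (simp add: det_2 matrix_def A_def axis_def)
  have "inr / 2 * (touch v \<bullet> b - touch u \<bullet> b) - outr * gap u v \<le> \<bar>det (matrix A)\<bar>"
  proof -
    have py: "p \<bullet> (a + v *\<^sub>R b) = gap u v"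
      using touch_inner[of v] by (simp add: p_def gap_def inner_diff_left)
    have qy: "q \<bullet> (a + v *\<^sub>R b) = h v - gap u v"
      by (simp add: q_def gap_def)
    \<comment> \<open>Replacing \<open>a\<close> by \<open>a + v *\<^sub>R b\<close> is a column
      operation and leaves the determinant unchanged; on that vector both inner products are
      known.\<close>
    have "(q \<bullet> a) * (p \<bullet> b) - (q \<bullet> b) * (p \<bullet> a)
       = (p \<bullet> b) * (q \<bullet> (a + v *\<^sub>R b)) - (q \<bullet> b) * (p \<bullet> (a + v *\<^sub>R b))"
      by (simp add: inner_add_right algebra_simps)
    also have "\<dots> = (p \<bullet> b) * (h v - gap u v) - (q \<bullet> b) * gap u v" by (simp only: py qy)
    finally have e: "\<bar>det (matrix A)\<bar> = \<bar>(p \<bullet> b) * (h v - gap u v) - (q \<bullet> b) * gap u v\<bar>"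
      unfolding det abs_cross_signed_frame by simp
    have pb: "p \<bullet> b \<ge> 0" using touch_mono[OF uv] by (simp add: p_def inner_diff_left)
    \<comment> \<open>Since \<open>gap u v\<close> is at most \<delta>, hence at most
      \<open>inr / 2\<close>, half of the lower bound \<open>inr\<close> for \<open>h v\<close>
      survives.\<close>
    have "(p \<bullet> b) * (inr / 2) \<le> (p \<bullet> b) * (h v - gap u v)"
      using h_lower[of v] gap \<delta> pb by (intro mult_left_mono) auto
    moreover have "(q \<bullet> b) * gap u v \<le> outr * gap u v"
    proof (rule mult_right_mono[OF _ gap_nonneg])
      have "q \<bullet> b \<le> norm q * norm b" by (rule norm_cauchy_schwarz)
      then show "q \<bullet> b \<le> outr"
        using outr(2)[OF touch_closure, of u] signed_frame_inner[OF frame] by (simp add: q_def norm_eq_sqrt_inner[of b])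
    qed
    ultimately have "inr / 2 * (p \<bullet> b) - outr * gap u v \<le> \<bar>det (matrix A)\<bar>" unfolding e by argo
    then show ?thesis by (simp add: p_def inner_diff_left)
  qed
  then have "\<delta> / 2 * (inr / 2 * (touch v \<bullet> b - touch u \<bullet> b) - outr * gap u v) \<le> measure lebesgue (A ` ?B)"
    unfolding measure_linear_image[OF lin lmeasurable_box] Bm using \<delta> by (simp add: mult.commute mult_right_mono)
  then have "ennreal (\<delta> / 2 * (inr / 2 * (touch v \<bullet> b - touch u \<bullet> b) - outr * gap u v))
      \<le> ennreal (measure lebesgue (A ` ?B))"
    by (rule ennreal_leI)
  also have "\<dots> = emeasure lebesgue (A ` ?B)"
    using measurable_linear_image[OF lin lmeasurable_box] by (simp add: emeasure_eq_measure2 fmeasurableD2 emeasure_eq_ennreal_measure top.not_eq_extremum)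
  also have "\<dots> \<le> emeasure lebesgue (slab \<delta> v)"
    using sub by (intro emeasure_mono) auto
  also have "\<dots> = emeasure lborel (slab \<delta> v)" by simp
  finally show ?thesis .
qed

end

subsection \<open>Chains of supporting lines\<close>

text \<open>The negative part of \<open>f\<close> only lowers the left-hand side, and a
  non-integrable \<open>f\<close> has integral 0.\<close>

lemma ennreal_integral_le:
  fixes f :: "'a \<Rightarrow> real"
  shows "ennreal (LINT x|M. f x) \<le> (\<integral>\<^sup>+ x. ennreal (f x) \<partial>M)"
proof (cases "integrable M f")
  case True
  then have "(LINT x|M. f x) \<le> enn2real (\<integral>\<^sup>+ x. ennreal (f x) \<partial>M)"
    by (simp add: real_lebesgue_integral_def)
  moreover have "(\<integral>\<^sup>+ x. ennreal (f x) \<partial>M) < \<infinity>"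
    using True by (simp add: real_integrable_def less_top)
  ultimately show ?thesis using ennreal_leI by fastforce
qed (simp add: not_integrable_integral_eq)

text \<open>\<open>ennreal\<close> truncates at 0, and truncation is subadditive. Signs matter here
  because the bound for a single chain step may be negative.\<close>

lemma ennreal_add_le: "ennreal (x + y) \<le> ennreal x + ennreal y"
proof -
  have "ennreal (x + y) \<le> ennreal (max 0 x + max 0 y)" by (rule ennreal_leI) simp
  also have "\<dots> = ennreal x + ennreal y" by (simp add: max_def ennreal_neg)
  finally show ?thesis .
qed

text \<open>A substitute for integrating the derivative of a convex function over \<open>{u..w}\<close>.\<close>

lemma integral_difference_quotient_ge:
  fixes f :: "real \<Rightarrow> real"
  assumes f: "continuous_on {u..w} f" and mono: "\<And>x y. u \<le> x \<Longrightarrow> x \<le> y \<Longrightarrow> y \<le> w \<Longrightarrow> f x \<le> f y"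
    and e: "0 < e" "u + e \<le> w - e"
  shows "integral {u + e..w} (\<lambda>v. (f v - f (v - e)) / e) \<ge> f (w - e) - f (u + e)"
proof -
  have c: "continuous_on S f" if "S \<subseteq> {u..w}" for S using f that by (rule continuous_on_subset)
  have i: "f integrable_on {x..y}" if "u \<le> x" "y \<le> w" for x y
    using that by (intro integrable_continuous_real c) auto
  have c': "continuous_on {u + e..w} (\<lambda>v. f (v - e))"
    by (rule continuous_on_compose2[OF f]) (use e in \<open>auto intro!: continuous_intros\<close>)
  have "integral {u + e..w} (\<lambda>v. (f v - f (v - e)) / e)
      = (integral {u + e..w} f - integral {u + e..w} (\<lambda>v. f (v - e))) / e"
    using e c' by (simp add: i integral_diff integrable_continuous_real)
  \<comment> \<open>The shifted integral cancels the common middle range; what remains are integrals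
    over a last and a first stretch of length \<open>e\<close>, which monotonicity bounds.\<close>
  also have "integral {u + e..w} (\<lambda>v. f (v - e)) = integral {u..w - e} f"
    using integral_shift[of "u + e" "- e" w f] c[of "{u..w - e}"] e by (simp add: o_def)
  also have "integral {u + e..w} f = integral {u + e..w - e} f + integral {w - e..w} f"
    using e by (intro Henstock_Kurzweil_Integration.integral_combine[symmetric] i) auto
  also have "integral {u..w - e} f = integral {u..u + e} f + integral {u + e..w - e} f"
    using e by (intro Henstock_Kurzweil_Integration.integral_combine[symmetric] i) auto
  finally have eq: "integral {u + e..w} (\<lambda>v. (f v - f (v - e)) / e) = (integral {w - e..w} f - integral {u..u + e} f) / e"
    by simp
  have "integral {w - e..w} (\<lambda>_. f (w - e)) \<le> integral {w - e..w} f"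
    using e by (intro integral_le i mono) auto
  moreover have "integral {u..u + e} f \<le> integral {u..u + e} (\<lambda>_. f (u + e))"
    using e by (intro integral_le i mono) auto
  ultimately have "e * (f (w - e) - f (u + e)) \<le> integral {w - e..w} f - integral {u..u + e} f"
    using e by (simp add: algebra_simps)
  then show ?thesis unfolding eq using e by (simp add: pos_le_divide_eq mult.commute)
qed

context convex_chart
begin

text \<open>\<open>n\<close> counts steps, so the slopes are \<open>w 0\<close> to
  \<open>w n\<close>. Equality of the gaps with \<delta> serves two purposes: as an upper bound it
  makes the lines cover, as a lower bound it gives each step its share of measure.\<close>

definition chain :: "real \<Rightarrow> nat \<Rightarrow> (nat \<Rightarrow> real) \<Rightarrow> bool" where
  "chain \<delta> n w \<longleftrightarrow> w 0 = -1 \<and> w n \<le> 1 \<and> (\<forall>i<n. w i < w (Suc i) \<and> gap (w i) (w (Suc i)) = \<delta>)"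

text \<open>Greedy construction by the intermediate value theorem, stopped after \<open>n\<close>
  steps. That it ends by itself, with \<open>gap (w m) 1 < \<delta>\<close>, follows later from the
  bound on the length of chains.\<close>

lemma chain_exists:
  assumes \<delta>: "\<delta> > 0"
  shows "\<exists>m w. m \<le> n \<and> chain \<delta> m w \<and> (m = n \<or> gap (w m) 1 < \<delta>)"
proof (induction n)
  case 0
  show ?case by (rule exI[of _ 0], rule exI[of _ "\<lambda>_. -1"]) (simp add: chain_def)
next
  case (Suc n)
  then obtain m w where mw: "m \<le> n" "chain \<delta> m w" "m = n \<or> gap (w m) 1 < \<delta>" by blast
  show ?case
  proof (cases "gap (w m) 1 < \<delta>")
    case True
    then show ?thesis using mw le_SucI by blast
  next
    case False
    then have mn: "m = n" using mw by blast
    have "\<exists>x\<ge>w n. x \<le> 1 \<and> gap (w n) x = \<delta>"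
      using False \<delta> mw gap_self[of "w n"] by (intro IVT' continuous_gap) (auto simp: mn chain_def)
    then obtain x where x: "w n \<le> x" "x \<le> 1" "gap (w n) x = \<delta>" by blast
    have "x \<noteq> w n" using x \<delta> gap_self by auto
    then have "chain \<delta> (Suc n) (w(Suc n := x))"
      using x mw by (auto simp: chain_def mn less_Suc_eq)
    then show ?thesis by blast
  qed
qed

lemma chain_mono:
  assumes "chain \<delta> n w" "i \<le> j" "j \<le> n"
  shows "w i \<le> w j"
  using assms(2,3)
proof (induction j rule: dec_induct)
  case (step m)
  then have "w i \<le> w m" "w m < w (Suc m)" using assms(1) by (simp_all add: chain_def)
  then show ?case by simp
qed simp

text \<open>Unless \<open>u = -1\<close>, the slope \<open>u\<close> lies in a step of the chain or
  beyond \<open>w n\<close>, and the line at the right end of that range is close to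
  \<open>x\<close>. The additional slope 1 is the right end of the last range.\<close>

lemma chain_cover:
  assumes ch: "chain \<delta> n w" and last: "gap (w n) 1 < \<delta>"
    and u: "-1 \<le> u" "u \<le> 1" and x: "maximizer x u"
  shows "\<exists>c\<in>insert 1 (w ` {..n}). h c - x \<bullet> (a + c *\<^sub>R b) \<le> \<delta>"
proof -
  have \<delta>: "\<delta> \<ge> 0" using last gap_nonneg by (meson less_imp_le order_trans)
  consider "u = -1" | "w n < u" | "u > -1" "u \<le> w n" using u by linarith
  then show ?thesis
  proof cases
    case 1
    then have "h (w 0) - x \<bullet> (a + w 0 *\<^sub>R b) \<le> \<delta>" using x ch \<delta> by (simp add: chain_def maximizer_def)
    then show ?thesis by blast
  next
    case 2
    then have "h 1 - x \<bullet> (a + 1 *\<^sub>R b) \<le> \<delta>" using gap_maximizer_le[OF x 2 u(2)] last by simp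
    then show ?thesis by blast
  next
    case 3
    define i where "i = (LEAST i. u \<le> w i)"
    have i: "u \<le> w i" "i \<le> n" unfolding i_def using 3 by (auto intro: LeastI Least_le)
    have "i \<noteq> 0" using i 3 ch by (auto simp: chain_def intro!: gr0I)
    then obtain j where j: "i = Suc j" by (cases i) auto
    have "w j < u" using not_less_Least[of j "\<lambda>i. u \<le> w i"] j by (simp add: i_def[symmetric])
    then have "h (w i) - x \<bullet> (a + w i *\<^sub>R b) \<le> gap (w j) (w i)" using gap_maximizer_le[OF x _ i(1)] by blast
    also have "\<dots> = \<delta>" using ch i j by (simp add: chain_def)
    finally show ?thesis using i by blast
  qed
qed

lemma measurable_slab_indicator[measurable]:
  "(\<lambda>(v, \<eta>). indicator (slab \<delta> v) \<eta> :: ennreal) \<in> borel_measurable (lborel \<Otimes>\<^sub>M lborel)"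
proof -
  have [measurable]: "\<Omega> \<in> sets borel" using open_domain by simp
  have "{z \<in> space (lborel \<Otimes>\<^sub>M lborel). snd z \<in> slab \<delta> (fst z)} \<in> sets (lborel \<Otimes>\<^sub>M lborel)"
    unfolding slab_def mem_Collect_eq by measurable
  then have "(\<lambda>z. indicator {z \<in> space (lborel \<Otimes>\<^sub>M lborel). snd z \<in> slab \<delta> (fst z)} z :: ennreal) \<in> borel_measurable (lborel \<Otimes>\<^sub>M lborel)"
    by (rule borel_measurable_indicator)
  then show ?thesis by (simp add: indicator_def case_prod_beta' space_pair_measure)
qed

lemma measurable_emeasure_slab[measurable]: "(\<lambda>v. emeasure lborel (slab \<delta> v)) \<in> borel_measurable borel"
proof -
  have "(\<lambda>v. \<integral>\<^sup>+ \<eta>. indicator (slab \<delta> v) \<eta> \<partial>lborel) \<in> borel_measurable lborel"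
    by (rule lborel.borel_measurable_nn_integral) measurable
  then show ?thesis by simp
qed

text \<open>The slab at \<open>v\<close> has measure at least of order \<delta> times the slope
  increment from \<open>u\<close> to \<open>v\<close>, up to an error. That increment dominates the
  derivative of \<open>gap u\<close>, whose integral over the step is
  \<open>gap u w = \<delta>\<close>. Difference quotients replace the derivative.\<close>

lemma slab_integral_step:
  assumes \<delta>: "0 < \<delta>" "\<delta> \<le> 1/4" "\<delta> \<le> inr / 2"
    and uw: "-1 \<le> u" "u < w" "w \<le> 1" and gap: "gap u w = \<delta>"
  shows "(\<integral>\<^sup>+ v. indicator {u<..w} v * emeasure lborel (slab \<delta> v) \<partial>lborel)
    \<ge> ennreal (\<delta> / 2 * (inr / 4 * \<delta> - outr * \<delta> * (w - u)))"
proof -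
  \<comment> \<open>Choose \<open>e\<close> so small that trimming both ends costs at most half of
    the total increase \<delta>; this turns the factor \<open>inr / 2\<close> into
    \<open>inr / 4\<close>.\<close>
  have "((\<lambda>e. gap u (w - e) - gap u (u + e)) \<longlongrightarrow> gap u (w - 0) - gap u (u + 0)) (at_right 0)"
    using continuous_gap[of UNIV u]
    by (intro tendsto_intros continuous_on_tendsto_compose[OF continuous_gap[of UNIV u]]) auto
  then have "eventually (\<lambda>e. gap u (w - e) - gap u (u + e) > \<delta> / 2) (at_right 0)"
    using \<delta> gap gap_self[of u] by (intro order_tendstoD(1)) auto
  moreover have "eventually (\<lambda>e. e \<in> {0<..<(w - u) / 2}) (at_right 0)"
    using uw by (intro eventually_at_right_real) auto
  ultimately have "eventually (\<lambda>e. gap u (w - e) - gap u (u + e) > \<delta> / 2 \<and> e \<in> {0<..<(w - u) / 2}) (at_right 0)"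
    by eventually_elim auto
  then obtain e where e: "gap u (w - e) - gap u (u + e) > \<delta> / 2" "0 < e" "e < (w - u) / 2"
    using eventually_happens[of _ "at_right (0::real)"] by (auto simp: trivial_limit_at_right_real)
  define q where "q v = (gap u v - gap u (v - e)) / e" for v
  have cq: "continuous_on A q" for A
    unfolding q_def by (intro continuous_intros continuous_on_compose2[OF continuous_gap[of UNIV]]) (use e in auto)
  \<comment> \<open>A continuous minorant of the measure of the slab; the slope
    \<open>touch v \<bullet> b\<close> itself may jump.\<close>
  define L where "L v = \<delta> / 2 * (inr / 2 * q v - outr * gap u v)" for v
  have cL: "continuous_on A L" for A unfolding L_def by (intro continuous_intros cq continuous_gap)
  have int: "f integrable_on {u + e..w}" if "continuous_on {u + e..w} f" for f :: "real \<Rightarrow> real"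
    using that by (rule integrable_continuous_real)
  have "gap u (w - e) - gap u (u + e) \<le> integral {u + e..w} q"
    unfolding q_def using e by (intro integral_difference_quotient_ge continuous_gap gap_mono) auto
  then have "\<delta> / 2 \<le> integral {u + e..w} q" using e by simp
  moreover have "integral {u + e..w} (gap u) \<le> \<delta> * (w - u)"
  proof -
    have "integral {u + e..w} (gap u) \<le> integral {u + e..w} (\<lambda>_. \<delta>)"
      using e gap gap_mono[of u _ w] by (intro integral_le int continuous_gap continuous_intros) auto
    also have "\<dots> \<le> \<delta> * (w - u)" using e \<delta> by (simp add: mult.commute mult_left_mono)
    finally show ?thesis .
  qed
  moreover have "integral {u + e..w} L
      = \<delta> / 2 * (inr / 2 * integral {u + e..w} q - outr * integral {u + e..w} (gap u))"
    unfolding L_def by (simp add: integral_diff int continuous_on_mult_left cq continuous_gap)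
  ultimately have "\<delta> / 2 * (inr / 4 * \<delta> - outr * \<delta> * (w - u)) \<le> integral {u + e..w} L"
  proof -
    assume 1: "\<delta> / 2 \<le> integral {u + e..w} q" and 2: "integral {u + e..w} (gap u) \<le> \<delta> * (w - u)"
      and 3: "integral {u + e..w} L = \<delta> / 2 * (inr / 2 * integral {u + e..w} q - outr * integral {u + e..w} (gap u))"
    have 4: "inr / 2 * (\<delta> / 2) \<le> inr / 2 * integral {u + e..w} q" using 1 inr by (intro mult_left_mono) auto
    have 5: "outr * integral {u + e..w} (gap u) \<le> outr * (\<delta> * (w - u))" using 2 outr by (intro mult_left_mono) auto
    have "inr / 4 * \<delta> - outr * \<delta> * (w - u) \<le> inr / 2 * integral {u + e..w} q - outr * integral {u + e..w} (gap u)"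
      using 4 5 by argo
    then show ?thesis unfolding 3 using \<delta> by (intro mult_left_mono) auto
  qed
  also have "\<dots> = (LINT v|lborel. indicator {u + e..w} v * L v)"
    using set_borel_integral_eq_integral(2)[OF borel_integrable_atLeastAtMost'[OF cL]]
    by (simp add: set_lebesgue_integral_def)
  finally have "ennreal (\<delta> / 2 * (inr / 4 * \<delta> - outr * \<delta> * (w - u)))
      \<le> ennreal (LINT v|lborel. indicator {u + e..w} v * L v)" by (rule ennreal_leI)
  also have "\<dots> \<le> (\<integral>\<^sup>+ v. ennreal (indicator {u + e..w} v * L v) \<partial>lborel)" by (rule ennreal_integral_le)
  also have "\<dots> \<le> (\<integral>\<^sup>+ v. indicator {u<..w} v * emeasure lborel (slab \<delta> v) \<partial>lborel)"
  proof (rule nn_integral_mono)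
    fix v
    show "ennreal (indicator {u + e..w} v * L v) \<le> indicator {u<..w} v * emeasure lborel (slab \<delta> v)"
    proof (cases "v \<in> {u + e..w}")
      case True
      have g: "gap u v \<le> \<delta>" using True e gap gap_mono[of u v w] by auto
      have "q v \<le> touch v \<bullet> b - touch u \<bullet> b"
        using gap_diff_le[of u v "v - e"] e by (simp add: q_def field_simps)
      then have "L v \<le> \<delta> / 2 * (inr / 2 * (touch v \<bullet> b - touch u \<bullet> b) - outr * gap u v)"
        unfolding L_def using \<delta> inr by (intro mult_left_mono diff_right_mono) auto
      then have "ennreal (L v) \<le> ennreal (\<delta> / 2 * (inr / 2 * (touch v \<bullet> b - touch u \<bullet> b) - outr * gap u v))"
        by (rule ennreal_leI)
      also have "\<dots> \<le> emeasure lborel (slab \<delta> v)"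
        using True e uw g by (intro emeasure_slab_ge \<delta>) auto
      finally show ?thesis using True e by simp
    qed simp
  qed
  finally show ?thesis .
qed

text \<open>The steps occupy disjoint ranges of \<open>v\<close>, so the main terms add up, while
  the error terms telescope to the length of the range of slopes, at most 2.\<close>

lemma slab_integral_chain:
  assumes \<delta>: "0 < \<delta>" "\<delta> \<le> 1/4" "\<delta> \<le> inr / 2" and ch: "chain \<delta> n w"
  shows "(\<integral>\<^sup>+ v. indicator {-1..1} v * emeasure lborel (slab \<delta> v) \<partial>lborel)
    \<ge> ennreal (\<delta>\<^sup>2 / 2 * (inr / 4 * real n - 2 * outr))"
proof -
  let ?S = "\<lambda>v. emeasure lborel (slab \<delta> v)"
  have "(\<integral>\<^sup>+ v. indicator {-1<..w k} v * ?S v \<partial>lborel)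
      \<ge> ennreal (\<delta> / 2 * (inr / 4 * \<delta> * real k - outr * \<delta> * (w k + 1)))" if "k \<le> n" for k
    using that
  proof (induction k)
    case 0
    then show ?case using ch by (simp add: chain_def)
  next
    case (Suc k)
    have wk: "-1 \<le> w k" "w k < w (Suc k)" "w (Suc k) \<le> 1" "gap (w k) (w (Suc k)) = \<delta>"
      using ch Suc.prems chain_mono[OF ch, of 0 k] chain_mono[OF ch, of "Suc k" n] by (auto simp: chain_def)
    have "\<delta> / 2 * (inr / 4 * \<delta> * real (Suc k) - outr * \<delta> * (w (Suc k) + 1))
      = \<delta> / 2 * (inr / 4 * \<delta> * real k - outr * \<delta> * (w k + 1))
        + \<delta> / 2 * (inr / 4 * \<delta> - outr * \<delta> * (w (Suc k) - w k))"
      by (simp add: algebra_simps)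
    then have "ennreal (\<delta> / 2 * (inr / 4 * \<delta> * real (Suc k) - outr * \<delta> * (w (Suc k) + 1)))
      \<le> ennreal (\<delta> / 2 * (inr / 4 * \<delta> * real k - outr * \<delta> * (w k + 1)))
        + ennreal (\<delta> / 2 * (inr / 4 * \<delta> - outr * \<delta> * (w (Suc k) - w k)))"
      using ennreal_add_le by metis
    also have "\<dots> \<le> (\<integral>\<^sup>+ v. indicator {-1<..w k} v * ?S v \<partial>lborel) + (\<integral>\<^sup>+ v. indicator {w k<..w (Suc k)} v * ?S v \<partial>lborel)"
      using Suc wk by (intro add_mono slab_integral_step \<delta>) auto
    also have "\<dots> = (\<integral>\<^sup>+ v. indicator {-1<..w k} v * ?S v + indicator {w k<..w (Suc k)} v * ?S v \<partial>lborel)"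
      by (rule nn_integral_add[symmetric]) measurable
    also have "\<dots> = (\<integral>\<^sup>+ v. indicator {-1<..w (Suc k)} v * ?S v \<partial>lborel)"
      using wk by (intro nn_integral_cong) (auto simp: indicator_def)
    finally show ?case .
  qed
  from this[of n] have "ennreal (\<delta> / 2 * (inr / 4 * \<delta> * real n - outr * \<delta> * (w n + 1)))
      \<le> (\<integral>\<^sup>+ v. indicator {-1<..w n} v * ?S v \<partial>lborel)" by simp
  also have "\<dots> \<le> (\<integral>\<^sup>+ v. indicator {-1..1} v * ?S v \<partial>lborel)"
    using ch by (intro nn_integral_mono) (auto simp: indicator_def chain_def)
  finally have *: "ennreal (\<delta> / 2 * (inr / 4 * \<delta> * real n - outr * \<delta> * (w n + 1))) \<le> \<dots>" .
  have "outr * (w n + 1) \<le> outr * 2" using ch outr by (intro mult_left_mono) (auto simp: chain_def)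
  then have "\<delta>\<^sup>2 / 2 * (inr / 4 * real n - 2 * outr) \<le> \<delta>\<^sup>2 / 2 * (inr / 4 * real n - outr * (w n + 1))"
    by (intro mult_left_mono) auto
  also have "\<dots> = \<delta> / 2 * (inr / 4 * \<delta> * real n - outr * \<delta> * (w n + 1))"
    by (simp add: power2_eq_square algebra_simps)
  finally show ?thesis using * ennreal_leI order_trans by blast
qed

end

subsection \<open>The oscillatory pairing\<close>

text \<open>Used with the optimal \<open>B\<close> in place of Hoelder's inequality, so that \<open>p = 1\<close> is no special case.\<close>

lemma le_add_powr:
  fixes u B p :: real
  assumes "u \<ge> 0" "B > 0" "p \<ge> 1"
  shows "u \<le> B + B powr (1 - p) * u powr p"
proof (cases "u \<le> B")
  case True
  then show ?thesis using assms by (simp add: add_increasing2)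
next
  case False
  then have "u powr (1 - p) \<le> B powr (1 - p)" using assms by (intro powr_mono2') auto
  then have "u powr (1 - p) * u powr p \<le> B powr (1 - p) * u powr p" by (rule mult_right_mono) simp
  moreover have "u powr (1 - p) * u powr p = u" using False assms by (simp add: powr_add[symmetric])
  ultimately show ?thesis using assms by simp
qed

definition damping :: "real \<Rightarrow> R2 \<Rightarrow> R2 \<Rightarrow> R2 \<Rightarrow> real" where
  "damping \<delta> a b x = indicator (sector a b) x * exp (- \<delta> * (x \<bullet> a))"

lemma measurable_damping[measurable]: "damping \<delta> a b \<in> borel_measurable borel"
  unfolding damping_def by measurable

lemma damping_nonneg: "damping \<delta> a b x \<ge> 0"
  by (simp add: damping_def)

lemma damping_le_one: "\<delta> > 0 \<Longrightarrow> damping \<delta> a b x \<le> 1"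
  by (auto simp: damping_def indicator_def sector_def)

lemma nn_integral_damping:
  assumes fr: "signed_frame a b" and \<delta>: "\<delta> > 0"
  shows "(\<integral>\<^sup>+ x. ennreal (damping \<delta> a b x) \<partial>lborel) = ennreal (2 / \<delta>\<^sup>2)"
proof -
  have meas: "(\<lambda>x. ennreal (exp (- \<delta> * (x \<bullet> a)))) \<in> borel_measurable borel" by measurable
  have "(\<integral>\<^sup>+ x. ennreal (damping \<delta> a b x) \<partial>lborel)
      = (\<integral>\<^sup>+ x. indicator (sector a b) x * ennreal (exp (- \<delta> * (x \<bullet> a))) \<partial>lborel)"
    by (intro nn_integral_cong) (auto simp: damping_def indicator_def)
  also have "\<dots> = (\<integral>\<^sup>+ (t, v). (ennreal (t * exp (- \<delta> * t)) * indicator {0..} t) * indicator {-1..1::real} v \<partial>(lborel \<Otimes>\<^sub>M lborel))"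
    unfolding nn_integral_sector[OF fr, of "\<lambda>x. ennreal (exp (- \<delta> * (x \<bullet> a)))", OF meas]
  proof (rule nn_integral_cong, clarify)
    fix t v :: real
    show "ennreal (indicator {0<..} t * t) * indicator {-1..1} v * ennreal (exp (- \<delta> * ((t *\<^sub>R (a + v *\<^sub>R b)) \<bullet> a)))
       = ennreal (t * exp (- \<delta> * t)) * indicator {0..} t * indicator {-1..1} v"
      using signed_frame_inner[OF fr]
      by (cases "t > 0"; cases "t = 0") (simp_all add: inner_add_left ennreal_mult' ac_simps)
  qed
  also have "\<dots> = (\<integral>\<^sup>+ t. (ennreal (t * exp (- \<delta> * t)) * indicator {0..} t) * (\<integral>\<^sup>+ v. indicator {-1..1::real} v \<partial>lborel) \<partial>lborel)"
    by (subst lborel.nn_integral_fst[symmetric]) (auto simp: nn_integral_cmult)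
  also have "\<dots> = (\<integral>\<^sup>+ t. ennreal (t * exp (- \<delta> * t)) * indicator {0..} t \<partial>lborel) * ennreal 2"
    by (subst nn_integral_multc[symmetric]) auto
  also have "\<dots> = ennreal (2 / \<delta>\<^sup>2)"
    unfolding nn_integral_mult_exp_neg[OF \<delta>] by (subst ennreal_mult[symmetric]) auto
  finally show ?thesis .
qed

lemma integrable_damping:
  assumes "signed_frame a b" "\<delta> > 0"
  shows "integrable lborel (damping \<delta> a b)"
  using nn_integral_damping[OF assms] by (intro integrableI_nonneg) (auto simp: damping_nonneg)

text \<open>The choice \<open>B = \<delta> powr (2 / p)\<close> balances the two terms: the damping
  has mass \<open>2 / \<delta>\<^sup>2\<close>, and both \<open>B / \<delta>\<^sup>2\<close> and
  \<open>B powr (1 - p)\<close> equal \<open>\<delta> powr (2 / p - 2)\<close>.\<close>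

lemma nn_integral_damping_mult_le:
  assumes fr: "signed_frame a b" and \<delta>: "\<delta> > 0" and p: "p \<ge> 1" and [measurable]: "K \<in> borel_measurable borel"
    and A: "(\<integral>\<^sup>+ x. ennreal (norm (K x) powr p) \<partial>lborel) \<le> ennreal A" "A \<ge> 0"
  shows "(\<integral>\<^sup>+ x. ennreal (norm (K x) * damping \<delta> a b x) \<partial>lborel) \<le> ennreal ((2 + A) * \<delta> powr (2 / p - 2))"
proof -
  define B where "B = \<delta> powr (2 / p)"
  have B: "B > 0" using \<delta> by (simp add: B_def)
  have "(\<integral>\<^sup>+ x. ennreal (norm (K x) * damping \<delta> a b x) \<partial>lborel)
      \<le> (\<integral>\<^sup>+ x. ennreal B * ennreal (damping \<delta> a b x) + ennreal (B powr (1 - p)) * ennreal (norm (K x) powr p) \<partial>lborel)"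
  proof (rule nn_integral_mono)
    fix x
    let ?d = "damping \<delta> a b x"
    have "norm (K x) * ?d \<le> (B + B powr (1 - p) * norm (K x) powr p) * ?d"
      using B p by (intro mult_right_mono le_add_powr) (auto simp: damping_nonneg)
    also have "\<dots> \<le> B * ?d + B powr (1 - p) * norm (K x) powr p"
      using damping_le_one[OF \<delta>, of a b x] damping_nonneg[of \<delta> a b x]
      by (simp add: distrib_right mult_right_le_one_le)
    finally show "ennreal (norm (K x) * ?d) \<le> ennreal B * ennreal ?d + ennreal (B powr (1 - p)) * ennreal (norm (K x) powr p)"
      using B damping_nonneg[of \<delta> a b x]
      by (simp add: ennreal_mult[symmetric] ennreal_plus[symmetric] ennreal_leI del: ennreal_plus)
  qed
  also have "\<dots> = ennreal B * (\<integral>\<^sup>+ x. ennreal (damping \<delta> a b x) \<partial>lborel)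
      + ennreal (B powr (1 - p)) * (\<integral>\<^sup>+ x. ennreal (norm (K x) powr p) \<partial>lborel)"
    by (simp add: nn_integral_add nn_integral_cmult)
  also have "\<dots> \<le> ennreal B * ennreal (2 / \<delta>\<^sup>2) + ennreal (B powr (1 - p)) * ennreal A"
    unfolding nn_integral_damping[OF fr \<delta>] by (intro add_mono mult_left_mono A) auto
  also have "\<dots> = ennreal (B * (2 / \<delta>\<^sup>2) + B powr (1 - p) * A)"
    using B A by (simp add: ennreal_mult[symmetric] ennreal_plus[symmetric] del: ennreal_plus)
  also have "B * (2 / \<delta>\<^sup>2) + B powr (1 - p) * A = (2 + A) * \<delta> powr (2 / p - 2)"
  proof -
    have "B / \<delta>\<^sup>2 = \<delta> powr (2 / p - 2)" using \<delta> by (simp add: B_def powr_diff powr_numeral)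
    moreover have "B powr (1 - p) = \<delta> powr (2 / p - 2)"
      using p by (simp add: B_def powr_powr right_diff_distrib)
    ultimately have "2 * (B / \<delta>\<^sup>2) + B powr (1 - p) * A = (2 + A) * \<delta> powr (2 / p - 2)" by (simp add: algebra_simps)
    then show ?thesis by (simp add: mult.commute)
  qed
  finally show ?thesis .
qed

text \<open>Minus the imaginary part of the Laplace transform of \<open>t\<close> at \<delta> + 2
  \<pi> i s; the sign makes it nonnegative for \<open>s \<ge> 0\<close>.\<close>

definition osc_kernel :: "real \<Rightarrow> real \<Rightarrow> real" where
  "osc_kernel \<delta> s = - Im (1 / (Complex \<delta> (2 * pi * s))\<^sup>2)"

lemma osc_kernel_eq: "osc_kernel \<delta> s = 4 * pi * \<delta> * s / (\<delta>\<^sup>2 + (2 * pi * s)\<^sup>2)\<^sup>2"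
proof -
  define c where "c = 2 * pi * s"
  have sq: "(Complex \<delta> c)\<^sup>2 = Complex (\<delta>\<^sup>2 - c\<^sup>2) (2 * \<delta> * c)"
    by (simp add: complex_eq_iff power2_eq_square)
  have "(\<delta>\<^sup>2 - c\<^sup>2)\<^sup>2 + (2 * \<delta> * c)\<^sup>2 = (\<delta>\<^sup>2 + c\<^sup>2)\<^sup>2"
    by (simp add: power2_eq_square algebra_simps)
  then have "- Im (1 / (Complex \<delta> c)\<^sup>2) = 2 * \<delta> * c / (\<delta>\<^sup>2 + c\<^sup>2)\<^sup>2"
    unfolding sq by (simp add: Im_divide del: power_mult_distrib)
  then show ?thesis by (simp add: osc_kernel_def c_def)
qed

lemma osc_kernel_nonneg: "\<delta> > 0 \<Longrightarrow> s \<ge> 0 \<Longrightarrow> osc_kernel \<delta> s \<ge> 0"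
  by (simp add: osc_kernel_eq)

text \<open>When \<open>s\<close> is comparable to \<delta>, the numerator has order \<delta>
  squared and the denominator the fourth power of \<delta>.\<close>

lemma osc_kernel_ge:
  assumes \<delta>: "\<delta> > 0" and s: "r * \<delta> \<le> s" "s \<le> R * \<delta>" and r: "r > 0"
  shows "osc_kernel \<delta> s \<ge> 4 * pi * r / (1 + 4 * pi\<^sup>2 * R\<^sup>2)\<^sup>2 / \<delta>\<^sup>2"
proof -
  have s0: "s > 0" using s(1) \<delta> r by (meson less_le_trans mult_pos_pos)
  have "(2 * pi * s)\<^sup>2 \<le> (2 * pi * (R * \<delta>))\<^sup>2" using s s0 by (intro power_mono mult_left_mono) auto
  then have "\<delta>\<^sup>2 + (2 * pi * s)\<^sup>2 \<le> \<delta>\<^sup>2 * (1 + 4 * pi\<^sup>2 * R\<^sup>2)" by (simp add: power_mult_distrib algebra_simps)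
  then have d: "(\<delta>\<^sup>2 + (2 * pi * s)\<^sup>2)\<^sup>2 \<le> (\<delta>\<^sup>2 * (1 + 4 * pi\<^sup>2 * R\<^sup>2))\<^sup>2" by (intro power_mono) auto
  have "X / q\<^sup>2 / \<delta>\<^sup>2 = X * \<delta>\<^sup>2 / (\<delta>\<^sup>2 * q)\<^sup>2" for X q
    using \<delta> by (simp add: power2_eq_square)
  then have "4 * pi * r / (1 + 4 * pi\<^sup>2 * R\<^sup>2)\<^sup>2 / \<delta>\<^sup>2 = 4 * pi * \<delta> * (r * \<delta>) / (\<delta>\<^sup>2 * (1 + 4 * pi\<^sup>2 * R\<^sup>2))\<^sup>2"
    by (simp add: power2_eq_square ac_simps)
  also have "\<dots> \<le> osc_kernel \<delta> s"
    unfolding osc_kernel_eq using s s0 \<delta> r d by (intro frac_le mult_left_mono) (auto intro!: zero_less_power add_pos_nonneg)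
  finally show ?thesis .
qed

lemma norm_inverse_Complex_le: "\<delta> > 0 \<Longrightarrow> norm (1 / (Complex \<delta> c)\<^sup>2) \<le> 1 / \<delta>\<^sup>2"
  using abs_Re_le_cmod[of "Complex \<delta> c"] by (simp add: norm_divide norm_power frac_le power_mono)

lemma measurable_Complex[measurable]:
  assumes [measurable]: "f \<in> borel_measurable M" "g \<in> borel_measurable M"
  shows "(\<lambda>x. Complex (f x) (g x)) \<in> borel_measurable M"
  unfolding Complex_eq by measurable

context convex_chart
begin

text \<open>Along the ray through \<open>a + v *\<^sub>R b\<close> both the support function and the
  inner product with \<xi> are linear in \<open>t\<close>. The phase then has a constant frequency,
  proportional to the depth of \<xi> below the line at \<open>v\<close>, and the integral over
  \<open>t\<close> is a Laplace transform.\<close>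

lemma oscillatory_sector_integral:
  assumes \<delta>: "\<delta> > 0"
  shows "(LINT x|lborel. (complex_of_real (damping \<delta> a b x) * cis (- 2 * pi * supp x)) * cis (2 * pi * (x \<bullet> \<xi>)))
    = (LINT v|lborel. complex_of_real (indicator {-1..1} v) * (1 / (Complex \<delta> (2 * pi * (h v - \<xi> \<bullet> (a + v *\<^sub>R b))))\<^sup>2))"
proof -
  let ?D = "\<lambda>v. h v - \<xi> \<bullet> (a + v *\<^sub>R b)"
  let ?F = "\<lambda>x. complex_of_real (exp (- \<delta> * (x \<bullet> a))) * (cis (- 2 * pi * supp x) * cis (2 * pi * (x \<bullet> \<xi>)))"
  let ?e = "\<lambda>t. complex_of_real (indicator {0<..} t * (t * exp (- \<delta> * t)))"
  let ?g = "\<lambda>t v. (?e t * cis (- (2 * pi * ?D v) * t)) * complex_of_real (indicator {-1..1} v)"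
  have "(LINT x|lborel. (complex_of_real (damping \<delta> a b x) * cis (- 2 * pi * supp x)) * cis (2 * pi * (x \<bullet> \<xi>)))
      = (LINT x|lborel. complex_of_real (indicator (sector a b) x) * ?F x)"
    by (simp add: damping_def mult.assoc)
  also have "\<dots> = integral\<^sup>L (lborel \<Otimes>\<^sub>M lborel) (\<lambda>(t, v). complex_of_real (indicator {0<..} t * t * indicator {-1..1} v) * ?F (t *\<^sub>R (a + v *\<^sub>R b)))"
    by (rule integral_sector[OF frame]) measurable
  also have "(\<lambda>(t, v). complex_of_real (indicator {0<..} t * t * indicator {-1..1} v) * ?F (t *\<^sub>R (a + v *\<^sub>R b))) = (\<lambda>(t, v). ?g t v)"
  proof (intro ext, clarify)
    fix t v :: real
    show "complex_of_real (indicator {0<..} t * t * indicator {-1..1} v) * ?F (t *\<^sub>R (a + v *\<^sub>R b)) = ?g t v"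
    proof (cases "t > 0")
      case True
      have 1: "(t *\<^sub>R (a + v *\<^sub>R b)) \<bullet> a = t" using signed_frame_inner[OF frame] by (simp add: inner_add_left)
      have 2: "supp (t *\<^sub>R (a + v *\<^sub>R b)) = t * h v" using True by (simp add: h_def supp_scale)
      have 3: "cis (- 2 * pi * (t * h v)) * cis (2 * pi * ((t *\<^sub>R (a + v *\<^sub>R b)) \<bullet> \<xi>)) = cis (- (2 * pi * ?D v) * t)"
        unfolding cis_mult by (simp add: inner_commute algebra_simps)
      show ?thesis unfolding 1 2 3 using True by simp
    qed simp
  qed
  also have "integral\<^sup>L (lborel \<Otimes>\<^sub>M lborel) (\<lambda>(t, v). ?g t v) = (LINT v|lborel. LINT t|lborel. ?g t v)"
  proof (rule lborel_pair.integral_snd[symmetric], rule lborel_pair.Fubini_integrable)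
    have "integrable lborel (\<lambda>t. norm (?e t) * (LINT v|lborel. norm (complex_of_real (indicator {-1..1::real} v))))"
      using integrable_mult_exp_neg[OF \<delta>] by (intro integrable_mult_left integrable_norm) (simp del: of_real_mult)
    then show "integrable lborel (\<lambda>t. LINT v|lborel. norm (case (t, v) of (t, v) \<Rightarrow> ?g t v))"
      by (simp add: norm_mult)
    show "AE t in lborel. integrable lborel (\<lambda>v. case (t, v) of (t, v) \<Rightarrow> ?g t v)"
    proof (rule AE_I2)
      fix t
      have "integrable lborel (\<lambda>v. ?e t * (complex_of_real (indicator {-1..1::real} v) * cis (- (2 * pi * ?D v) * t)))"
        by (intro integrable_mult_right integrable_mult_cis) (auto intro!: integrable_real_indicator)
      then show "integrable lborel (\<lambda>v. case (t, v) of (t, v) \<Rightarrow> ?g t v)" by (simp add: ac_simps)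
    qed
  qed measurable
  also have "\<dots> = (LINT v|lborel. complex_of_real (indicator {-1..1} v) * (1 / (Complex \<delta> (2 * pi * ?D v))\<^sup>2))"
  proof (rule Bochner_Integration.integral_cong[OF refl])
    fix v
    have "(LINT t|lborel. ?g t v) = (LINT t|lborel. ?e t * cis (- (2 * pi * ?D v) * t)) * complex_of_real (indicator {-1..1} v)"
      by (rule integral_mult_left_zero)
    then show "(LINT t|lborel. ?g t v) = complex_of_real (indicator {-1..1} v) * (1 / (Complex \<delta> (2 * pi * ?D v))\<^sup>2)"
      unfolding laplace_identity_complex[OF \<delta>] by (simp only: mult.commute)
  qed
  finally show ?thesis .
qed

text \<open>Two exchanges write the pairing of \<open>K\<close> with the damped phase as an integral
  of \<open>M\<close> against the Laplace kernel over \<xi> and \<open>v\<close>. Depths are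
  nonnegative where \<open>M\<close> lives, so minus the imaginary part is an integral of
  nonnegative terms, and it is at most the modulus of the pairing.\<close>

lemma oscillatory_pairing_ge:
  fixes M :: "R2 \<Rightarrow> real"
  assumes \<delta>: "\<delta> > 0" and M: "integrable lborel M" "\<And>\<xi>. M \<xi> \<ge> 0" "\<And>\<xi>. \<xi> \<notin> \<Omega> \<Longrightarrow> M \<xi> = 0"
    and K: "\<And>x. K x = (LINT \<xi>|lborel. complex_of_real (M \<xi>) * cis (2 * pi * (x \<bullet> \<xi>)))"
  shows "(\<integral>\<^sup>+ v. indicator {-1..1} v * (\<integral>\<^sup>+ \<xi>. ennreal (M \<xi> * osc_kernel \<delta> (h v - \<xi> \<bullet> (a + v *\<^sub>R b))) \<partial>lborel) \<partial>lborel)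
     \<le> (\<integral>\<^sup>+ x. ennreal (norm (K x) * damping \<delta> a b x) \<partial>lborel)"
proof -
  let ?D = "\<lambda>v \<xi>. h v - \<xi> \<bullet> (a + v *\<^sub>R b)"
  let ?I = "\<lambda>v. complex_of_real (indicator {-1..1::real} v)"
  let ?k = "\<lambda>\<xi> v. 1 / (Complex \<delta> (2 * pi * ?D v \<xi>))\<^sup>2"
  let ?u = "\<lambda>x. complex_of_real (damping \<delta> a b x) * cis (- 2 * pi * supp x)"
  let ?w = "\<lambda>v. LINT \<xi>|lborel. complex_of_real (M \<xi>) * ?k \<xi> v"
  have [measurable]: "M \<in> borel_measurable borel" using M by simp
  have sf: "sigma_finite_measure lborel" by unfold_locales
  have kb: "norm (?k \<xi> v) \<le> 1 / \<delta>\<^sup>2" for \<xi> v by (rule norm_inverse_Complex_le[OF \<delta>])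
  have ui: "integrable lborel ?u" 
    using integrable_damping[OF frame \<delta>] by (intro integrable_mult_cis) (simp_all)
  have Mi: "integrable lborel (\<lambda>\<xi>. complex_of_real (M \<xi>))" using M by simp
  have Ii: "integrable lborel ?I" by (auto intro!: integrable_real_indicator)
  define P where "P = (LINT x|lborel. ?u x * K x)"
  have "P = (LINT \<xi>|lborel. complex_of_real (M \<xi>) * (LINT x|lborel. ?u x * cis (2 * pi * (x \<bullet> \<xi>))))"
    unfolding P_def K by (rule bounded_kernel_integral_swap[where C = 1, OF sf sf ui Mi]) (auto simp: case_prod_beta')
  also have "\<dots> = (LINT \<xi>|lborel. complex_of_real (M \<xi>) * (LINT v|lborel. ?I v * ?k \<xi> v))"
    unfolding oscillatory_sector_integral[OF \<delta>] ..
  also have "\<dots> = (LINT v|lborel. ?I v * ?w v)"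
    by (rule bounded_kernel_integral_swap[OF sf sf Mi Ii _ kb]) (simp add: case_prod_beta')
  finally have P: "P = (LINT v|lborel. ?I v * ?w v)" .
  have ki: "integrable lborel (\<lambda>\<xi>. complex_of_real (M \<xi>) * ?k \<xi> v)" for v
  proof (rule Bochner_Integration.integrable_bound)
    show "integrable lborel (\<lambda>\<xi>. M \<xi> * (1 / \<delta>\<^sup>2))" using M by (intro integrable_mult_left)
    show "AE \<xi> in lborel. norm (complex_of_real (M \<xi>) * ?k \<xi> v) \<le> norm (M \<xi> * (1 / \<delta>\<^sup>2))"
      using kb M(2) by (intro AE_I2) (simp only: norm_mult norm_of_real real_norm_def abs_mult, intro mult_left_mono, auto)
  qed measurable
  have wi: "integrable lborel (\<lambda>v. ?I v * ?w v)"
  proof (rule Bochner_Integration.integrable_bound)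
    define W where "W = (LINT \<xi>|lborel. M \<xi> * (1 / \<delta>\<^sup>2))"
    show "integrable lborel (\<lambda>v. indicator {-1..1::real} v * W)" by (intro integrable_mult_left) (auto intro!: integrable_real_indicator)
    have "norm (?w v) \<le> W" for v
      unfolding W_def
    proof (rule order_trans[OF integral_norm_bound], rule integral_mono)
      show "norm (complex_of_real (M \<xi>) * ?k \<xi> v) \<le> M \<xi> * (1 / \<delta>\<^sup>2)" for \<xi>
        using kb[of v \<xi>] M(2)[of \<xi>] unfolding norm_mult by (intro mult_mono) auto
    qed (use ki M in auto)
    then show "AE v in lborel. norm (?I v * ?w v) \<le> norm (indicator {-1..1} v * W)"
      by (intro AE_I2) (auto simp: norm_mult indicator_def simp del: mult_1_right intro: order_trans[OF _ abs_ge_self])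
  qed measurable
  define G where "G v = (LINT \<xi>|lborel. M \<xi> * osc_kernel \<delta> (?D v \<xi>))" for v
  have Gi: "integrable lborel (\<lambda>\<xi>. M \<xi> * osc_kernel \<delta> (?D v \<xi>))" for v
    using integrable_minus[OF integrable_Im[OF ki[of v]]] by (simp add: osc_kernel_def Im_divide)
  have G: "G v = - Im (?w v)" for v
  proof -
    have Im_mult_real: "Im (complex_of_real m * z) = m * Im z" for m z by simp
    show ?thesis unfolding integral_Im[OF ki, symmetric] G_def osc_kernel_def Im_mult_real mult_minus_right
      by (rule Bochner_Integration.integral_minus)
  qed
  have G0: "M \<xi> * osc_kernel \<delta> (?D v \<xi>) \<ge> 0" for v \<xi>
  proof (cases "\<xi> \<in> \<Omega>")
    case True
    then show ?thesis using h_ge[OF subsetD[OF closure_subset True], of v] M(2) by (auto intro!: mult_nonneg_nonneg osc_kernel_nonneg[OF \<delta>])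
  qed (simp add: M)
  have Gnn: "ennreal (G v) = (\<integral>\<^sup>+ \<xi>. ennreal (M \<xi> * osc_kernel \<delta> (?D v \<xi>)) \<partial>lborel)" for v
    unfolding G_def by (rule nn_integral_eq_integral[symmetric, OF Gi]) (simp add: G0)
  have "G v \<ge> 0" for v unfolding G_def using G0 by simp
  have IG: "integrable lborel (\<lambda>v. indicator {-1..1} v * G v)"
    using integrable_minus[OF integrable_Im[OF wi]] by (simp add: G)
  have "(\<integral>\<^sup>+ v. indicator {-1..1} v * (\<integral>\<^sup>+ \<xi>. ennreal (M \<xi> * osc_kernel \<delta> (?D v \<xi>)) \<partial>lborel) \<partial>lborel)
     = (\<integral>\<^sup>+ v. ennreal (indicator {-1..1} v * G v) \<partial>lborel)"
    unfolding Gnn[symmetric] by (intro nn_integral_cong) (auto simp: indicator_def)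
  also have "\<dots> = ennreal (LINT v|lborel. indicator {-1..1} v * G v)"
    using IG \<open>\<And>v. G v \<ge> 0\<close> by (intro nn_integral_eq_integral) auto
  also have "(LINT v|lborel. indicator {-1..1} v * G v) = - Im P"
    unfolding P integral_Im[OF wi, symmetric] by (simp add: G)
  also have "ennreal (- Im P) \<le> ennreal (norm P)"
    using abs_Im_le_cmod[of P] by (intro ennreal_leI) simp
  also have "\<dots> \<le> (\<integral>\<^sup>+ x. ennreal (norm (?u x * K x)) \<partial>lborel)"
    unfolding P_def by (rule ennreal_norm_integral_le)
  also have "\<dots> = (\<integral>\<^sup>+ x. ennreal (norm (K x) * damping \<delta> a b x) \<partial>lborel)"
    by (simp add: norm_mult damping_nonneg mult.commute)
  finally show ?thesis .
qed

end

subsection \<open>Covering the boundary by caps\<close>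

context convex_chart
begin

lemma chain_length_le:
  assumes bdd: "bounded_on_Lp (BR_op \<Omega> lam) p" and p: "p \<ge> 1" and lam: "lam \<ge> 0"
  shows "\<exists>C. \<forall>\<delta> n w. 0 < \<delta> \<longrightarrow> \<delta> \<le> 1/4 \<longrightarrow> \<delta> \<le> inr / 2 \<longrightarrow> chain \<delta> n w
           \<longrightarrow> real n \<le> C * (\<delta> powr (2 / p - 2 - lam) + 1)"
proof -
  \<comment> \<open>The transform of this Gaussian is positive everywhere, so on the bounded domain
    \<open>M\<close> is comparable to the multiplier.\<close>
  define f where "f x = complex_of_real (exp (- 1 * (norm x)\<^sup>2 / 2))" for x :: R2
  define M where "M \<xi> = br_multiplier \<Omega> lam \<xi> * (2 * pi * exp (- 2 * pi\<^sup>2 * (norm \<xi>)\<^sup>2))" for \<xi>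
  define K where "K = BR_op \<Omega> lam f"
  have [measurable]: "f \<in> borel_measurable borel" unfolding f_def by measurable
  have fi: "integrable lborel f" unfolding f_def using gaussian_2d(1)[of 1] by simp
  have ff: "fourier2 f \<xi> = complex_of_real (2 * pi * exp (- 2 * pi\<^sup>2 * (norm \<xi>)\<^sup>2))" for \<xi>
    unfolding f_def using gaussian_2d(2)[of 1] by simp
  have Kx: "K x = (LINT \<xi>|lborel. complex_of_real (M \<xi>) * cis (2 * pi * (x \<bullet> \<xi>)))" for x
    unfolding K_def BR_op_def inv_fourier2_def ff M_def by (simp add: mult.assoc)
  have Km[measurable]: "K \<in> borel_measurable borel"
    unfolding K_def BR_op_def inv_fourier2_eq[abs_def] by measurable
  have "integrable lborel (\<lambda>\<xi>. complex_of_real (br_multiplier \<Omega> lam \<xi>) * fourier2 f \<xi>)"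
    by (rule integrable_br_multiplier_mult[OF _ norm_fourier2_le]) measurable
  then have "integrable lborel (\<lambda>\<xi>. complex_of_real (M \<xi>))" by (simp add: ff M_def)
  then have Mi: "integrable lborel M" using integrable_Re by fastforce
  have M0: "M \<xi> \<ge> 0" for \<xi> by (simp add: M_def br_multiplier_nonneg)
  have Mout: "\<xi> \<notin> \<Omega> \<Longrightarrow> M \<xi> = 0" for \<xi> by (simp add: M_def br_multiplier_outside)

  have Sf: "(\<integral>\<^sup>+ x. ennreal (norm (f x) powr p) \<partial>lborel) < \<infinity>"
  proof -
    have "(\<integral>\<^sup>+ x. ennreal (norm (f x) powr p) \<partial>lborel) \<le> (\<integral>\<^sup>+ x. ennreal (norm (f x)) \<partial>lborel)"
    proof (intro nn_integral_mono ennreal_leI)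
      fix x
      have "norm (f x) \<le> 1" "norm (f x) > 0" by (auto simp: f_def)
      then show "norm (f x) powr p \<le> norm (f x)" using p powr_mono'[of 1 p "norm (f x)"] by simp
    qed
    also have "\<dots> < \<infinity>" using fi by (simp add: integrable_iff_bounded)
    finally show ?thesis .
  qed
  obtain C where C: "(\<integral>\<^sup>+ x. ennreal (norm (K x) powr p) \<partial>lborel)
      \<le> ennreal C * (\<integral>\<^sup>+ x. ennreal (norm (f x) powr p) \<partial>lborel)"
    using bdd fi Sf unfolding bounded_on_Lp_def in_Lp_def K_def by auto
  define A where "A = enn2real (ennreal C * (\<integral>\<^sup>+ x. ennreal (norm (f x) powr p) \<partial>lborel))"
  have A: "(\<integral>\<^sup>+ x. ennreal (norm (K x) powr p) \<partial>lborel) \<le> ennreal A" "A \<ge> 0"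
    using C Sf by (auto simp: A_def ennreal_mult_less_top)

  \<comment> \<open>\<open>c1\<close> bounds the Gaussian factor of \<open>M\<close> from below on
    the domain; \<open>c2\<close> is the constant of \<open>osc_kernel_ge\<close> for the depth
    range of \<open>slab\<close>.\<close>
  define c1 where "c1 = 2 * pi * exp (- 2 * pi\<^sup>2 * outr\<^sup>2)"
  define c2 where "c2 = 4 * pi * inr / (1 + 4 * pi\<^sup>2 * (4 * outr + 1)\<^sup>2)\<^sup>2"
  have c1: "c1 > 0" by (simp add: c1_def)
  have c2: "c2 > 0" unfolding c2_def using inr by (auto intro!: divide_pos_pos zero_less_power add_pos_nonneg)
  have ineq: "c1 * c2 / 2 * \<delta> powr lam * (inr / 4 * real n - 2 * outr) \<le> (2 + A) * \<delta> powr (2 / p - 2)"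
    if \<delta>: "0 < \<delta>" "\<delta> \<le> 1/4" "\<delta> \<le> inr / 2" and ch: "chain \<delta> n w" for \<delta> n w
  proof -
    \<comment> \<open>A lower bound for the integrand on each slab. Its factor
      \<open>1 / \<delta>\<^sup>2\<close> cancels the square of \<delta> in the measure bound,
      leaving \<open>\<delta> powr lam\<close> times the chain length.\<close>
    define c where "c = (c1 * \<delta> powr lam) * (c2 / \<delta>\<^sup>2)"
    have c0: "c \<ge> 0" using c1 c2 by (simp add: c_def)
    let ?D = "\<lambda>v \<xi>. h v - \<xi> \<bullet> (a + v *\<^sub>R b)"
    have pt: "c * indicator (slab \<delta> v) \<xi> \<le> M \<xi> * osc_kernel \<delta> (?D v \<xi>)" for v \<xi>
    proof (cases "\<xi> \<in> slab \<delta> v")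
      case True
      then have \<xi>: "inverse (1 - \<delta>) *\<^sub>R \<xi> \<in> \<Omega>" "inr * \<delta> \<le> ?D v \<xi>" "?D v \<xi> \<le> (4 * outr + 1) * \<delta>"
        by (auto simp: slab_def)
      have br: "\<delta> powr lam \<le> br_multiplier \<Omega> lam \<xi>" using \<delta> lam \<xi> by (intro br_multiplier_ge) auto
      have "\<xi> \<in> \<Omega>" using scale_mem[OF \<xi>(1), of "1 - \<delta>"] \<delta> by simp
      then have "norm \<xi> \<le> outr" using outr(2)[of \<xi>] closure_subset by blast
      then have "(norm \<xi>)\<^sup>2 \<le> outr\<^sup>2" by (rule power_mono) simp
      then have "c1 \<le> 2 * pi * exp (- 2 * pi\<^sup>2 * (norm \<xi>)\<^sup>2)" by (simp add: c1_def)
      then have "\<delta> powr lam * c1 \<le> M \<xi>" unfolding M_def using br c1 br_multiplier_nonneg by (intro mult_mono) auto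
      then have "(c1 * \<delta> powr lam) * (c2 / \<delta>\<^sup>2) \<le> M \<xi> * osc_kernel \<delta> (?D v \<xi>)"
        unfolding c2_def using \<delta> \<xi> inr M0 c2[unfolded c2_def]
        by (intro mult_mono osc_kernel_ge) (auto simp: mult.commute)
      then show ?thesis using True by (simp add: c_def)
    next
      case False
      have "0 \<le> M \<xi> * osc_kernel \<delta> (?D v \<xi>)"
      proof (cases "\<xi> \<in> \<Omega>")
        case True
        then show ?thesis using h_ge[OF subsetD[OF closure_subset True], of v] M0
          by (intro mult_nonneg_nonneg osc_kernel_nonneg \<delta>) auto
      qed (simp add: Mout)
      then show ?thesis using False by simp
    qed
    have "ennreal (c * (\<delta>\<^sup>2 / 2 * (inr / 4 * real n - 2 * outr)))
        = ennreal c * ennreal (\<delta>\<^sup>2 / 2 * (inr / 4 * real n - 2 * outr))"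
      using c0 by (rule ennreal_mult')
    also have "\<dots> \<le> ennreal c * (\<integral>\<^sup>+ v. indicator {-1..1} v * emeasure lborel (slab \<delta> v) \<partial>lborel)"
      by (intro mult_left_mono slab_integral_chain[OF \<delta> ch]) simp
    also have "\<dots> = (\<integral>\<^sup>+ v. indicator {-1..1} v * (\<integral>\<^sup>+ \<xi>. ennreal c * indicator (slab \<delta> v) \<xi> \<partial>lborel) \<partial>lborel)"
      by (subst nn_integral_cmult[symmetric]) (auto simp: nn_integral_cmult ac_simps)
    also have "\<dots> \<le> (\<integral>\<^sup>+ v. indicator {-1..1} v * (\<integral>\<^sup>+ \<xi>. ennreal (M \<xi> * osc_kernel \<delta> (?D v \<xi>)) \<partial>lborel) \<partial>lborel)"
    proof (intro nn_integral_mono mult_left_mono)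
      fix v \<xi>
      have "ennreal c * indicator (slab \<delta> v) \<xi> = ennreal (c * indicator (slab \<delta> v) \<xi>)"
        by (auto simp: indicator_def)
      also have "\<dots> \<le> ennreal (M \<xi> * osc_kernel \<delta> (?D v \<xi>))" using pt by (rule ennreal_leI)
      finally show "ennreal c * indicator (slab \<delta> v) \<xi> \<le> ennreal (M \<xi> * osc_kernel \<delta> (?D v \<xi>))" .
    qed simp
    also have "\<dots> \<le> (\<integral>\<^sup>+ x. ennreal (norm (K x) * damping \<delta> a b x) \<partial>lborel)"
      by (rule oscillatory_pairing_ge[OF \<delta>(1) Mi M0 Mout Kx])
    also have "\<dots> \<le> ennreal ((2 + A) * \<delta> powr (2 / p - 2))"
      by (rule nn_integral_damping_mult_le[OF frame \<delta>(1) p Km A])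
    finally have "c * (\<delta>\<^sup>2 / 2 * (inr / 4 * real n - 2 * outr)) \<le> (2 + A) * \<delta> powr (2 / p - 2)"
      using A(2) by (subst (asm) ennreal_le_iff) auto
    moreover have "c * (\<delta>\<^sup>2 / 2 * (inr / 4 * real n - 2 * outr)) = c1 * c2 / 2 * \<delta> powr lam * (inr / 4 * real n - 2 * outr)"
      using \<delta> by (simp add: c_def)
    ultimately show ?thesis by argo
  qed
  define d where "d = c1 * c2 / 2"
  have d: "d > 0" using c1 c2 by (simp add: d_def)
  \<comment> \<open>Comes from solving the inequality for \<open>n\<close>; the summand 1 in the
    claim absorbs the error \<open>2 * outr\<close>.\<close>
  define B where "B = 4 / inr * ((2 + A) / d + 2 * outr)"
  show ?thesis
  proof (intro exI[of _ B] allI impI)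
    fix \<delta> n w assume \<delta>: "0 < \<delta>" "\<delta> \<le> 1/4" "\<delta> \<le> inr / 2" "chain \<delta> n w"
    let ?X = "\<delta> powr (2 / p - 2 - lam)"
    have X0: "?X \<ge> 0" by simp
    have "inr / 4 * real n - 2 * outr \<le> (2 + A) * \<delta> powr (2 / p - 2) / (d * \<delta> powr lam)"
      using ineq[OF \<delta>] d \<delta>(1) by (simp add: pos_le_divide_eq d_def mult.commute)
    also have "\<dots> = (2 + A) / d * ?X" using \<delta> by (simp add: powr_diff)
    finally have "inr / 4 * real n \<le> (2 + A) / d * ?X + 2 * outr" by argo
    also have "\<dots> \<le> ((2 + A) / d + 2 * outr) * (?X + 1)"
      using X0 A d outr mult_nonneg_nonneg[of "2 * outr" ?X] divide_nonneg_pos[of "2 + A" d] by (simp add: algebra_simps)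
    finally have "4 / inr * (inr / 4 * real n) \<le> 4 / inr * (((2 + A) / d + 2 * outr) * (?X + 1))"
      using inr by (intro mult_left_mono) auto
    moreover have "4 / inr * (inr / 4 * real n) = real n" using inr(1) by simp
    ultimately show "real n \<le> B * (?X + 1)" unfolding B_def by (simp only: mult.assoc)
  qed
qed

text \<open>A greedy construction allowed more steps than any chain can have must stop by itself,
  and a chain that has stopped covers. The \<open>2\<close> added to the constant pays for
  \<open>w 0\<close> and for the extra slope 1.\<close>

lemma chart_cover:
  assumes bdd: "bounded_on_Lp (BR_op \<Omega> lam) p" and p: "p \<ge> 1" and lam: "lam \<ge> 0"
  shows "\<exists>C. \<forall>\<delta>. 0 < \<delta> \<longrightarrow> \<delta> \<le> 1/4 \<longrightarrow> \<delta> \<le> inr / 2 \<longrightarrow>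
     (\<exists>V. finite V \<and> real (card V) \<le> C * (\<delta> powr (2 / p - 2 - lam) + 1) \<and>
       (\<forall>u x. \<bar>u\<bar> \<le> 1 \<longrightarrow> maximizer x u \<longrightarrow> (\<exists>v\<in>V. h v - x \<bullet> (a + v *\<^sub>R b) \<le> \<delta>)))"
proof -
  obtain C where C: "\<And>\<delta> n w. 0 < \<delta> \<Longrightarrow> \<delta> \<le> 1/4 \<Longrightarrow> \<delta> \<le> inr / 2 \<Longrightarrow> chain \<delta> n w
           \<Longrightarrow> real n \<le> C * (\<delta> powr (2 / p - 2 - lam) + 1)"
    using chain_length_le[OF assms] by blast
  show ?thesis
  proof (intro exI[of _ "C + 2"] allI impI)
    fix \<delta> :: real assume \<delta>: "0 < \<delta>" "\<delta> \<le> 1/4" "\<delta> \<le> inr / 2"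
    let ?X = "\<delta> powr (2 / p - 2 - lam) + 1"
    obtain N :: nat where N: "real N > C * ?X" using reals_Archimedean2 by blast
    obtain m w where mw: "chain \<delta> m w" "m = N \<or> gap (w m) 1 < \<delta>"
      using chain_exists[OF \<delta>(1), of N] by blast
    have last: "gap (w m) 1 < \<delta>" using mw C[OF \<delta> mw(1)] N by auto
    let ?V = "insert 1 (w ` {..m})"
    show "\<exists>V. finite V \<and> real (card V) \<le> (C + 2) * ?X \<and>
       (\<forall>u x. \<bar>u\<bar> \<le> 1 \<longrightarrow> maximizer x u \<longrightarrow> (\<exists>v\<in>V. h v - x \<bullet> (a + v *\<^sub>R b) \<le> \<delta>))"
    proof (intro exI[of _ ?V] conjI allI impI)
      have "card ?V \<le> Suc (card (w ` {..m}))" by (rule card_insert_le_m1) auto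
      also have "\<dots> \<le> Suc (Suc m)" using card_image_le[of "{..m}" w] by simp
      finally have "real (card ?V) \<le> real m + 2" by simp
      also have "\<dots> \<le> C * ?X + 2 * ?X" using C[OF \<delta> mw(1)] by (intro add_mono) auto
      finally show "real (card ?V) \<le> (C + 2) * ?X" by (simp add: algebra_simps)
      fix u x assume "\<bar>u\<bar> \<le> 1" "maximizer x u"
      then show "\<exists>v\<in>?V. h v - x \<bullet> (a + v *\<^sub>R b) \<le> \<delta>" by (intro chain_cover[OF mw(1) last]) auto
    qed simp
  qed
qed

text \<open>A contact point inside the open domain could be moved along the normal past the
  maximum.\<close>

lemma touch_frontier: "touch v \<in> frontier \<Omega>"
proof -
  have "touch v \<notin> \<Omega>"
  proof
    assume t: "touch v \<in> \<Omega>"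
    obtain e where e: "e > 0" "ball (touch v) e \<subseteq> \<Omega>" using open_domain t openE by blast
    let ?y = "a + v *\<^sub>R b"
    let ?z = "touch v + (e / (2 * norm ?y)) *\<^sub>R ?y"
    have ny: "norm ?y \<ge> 1" by (rule norm_direction)
    have "?z \<in> ball (touch v) e" using e ny by (simp add: dist_norm)
    then have "?z \<bullet> ?y \<le> h v" using e closure_subset by (intro h_ge) blast
    then have "(e / (2 * norm ?y)) * (?y \<bullet> ?y) \<le> 0"
      using touch_inner[of v] by (simp only: inner_add_left[of "touch v"] inner_scaleR_left)
    moreover have "(e / (2 * norm ?y)) * (?y \<bullet> ?y) > 0" using e ny by (intro mult_pos_pos divide_pos_pos) auto
    ultimately show False by simp
  qed
  then show ?thesis using touch_closure open_domain by (simp add: frontier_def interior_open)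
qed

definition touch_line :: "real \<Rightarrow> R2 set" where
  "touch_line v = {x. x \<bullet> (a + v *\<^sub>R b) = h v}"

lemma supporting_touch_line: "supporting_line \<Omega> (touch v) (touch_line v)"
proof -
  have "a + v *\<^sub>R b \<noteq> 0" using norm_direction(1)[of v] by auto
  moreover have "0 \<le> h v" using h_lower[of v] inr by simp
  moreover have "\<Omega> \<subseteq> {x. x \<bullet> (a + v *\<^sub>R b) \<le> h v}" using h_ge closure_subset by blast
  ultimately show ?thesis
    unfolding supporting_line_def touch_line_def using touch_frontier touch_inner by blast
qed

text \<open>The foot \<open>?z\<close> of the perpendicular is at distance equal to the depth
  divided by the norm of the normal, and that norm is at least 1.\<close>

lemma infdist_touch_line_le:
  assumes "x \<in> closure \<Omega>"
  shows "infdist x (touch_line v) \<le> h v - x \<bullet> (a + v *\<^sub>R b)"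
proof -
  let ?y = "a + v *\<^sub>R b" and ?d = "h v - x \<bullet> (a + v *\<^sub>R b)"
  have ny: "norm ?y \<ge> 1" by (rule norm_direction)
  have d: "?d \<ge> 0" using h_ge[OF assms] by simp
  let ?z = "x + (?d / (?y \<bullet> ?y)) *\<^sub>R ?y"
  have yy: "?y \<bullet> ?y \<noteq> 0" using ny by auto
  have "?z \<bullet> ?y = x \<bullet> ?y + (?d / (?y \<bullet> ?y)) * (?y \<bullet> ?y)"
    by (simp only: inner_add_left[of x] inner_scaleR_left)
  then have "?z \<in> touch_line v" using yy by (simp add: touch_line_def)
  then have "infdist x (touch_line v) \<le> dist x ?z" by (rule infdist_le)
  also have "\<dots> = ?d / norm ?y"
  proof -
    have "dist x ?z = \<bar>?d / (?y \<bullet> ?y)\<bar> * norm ?y" by (simp add: dist_norm)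
    also have "\<dots> = ?d / norm ?y" unfolding power2_norm_eq_inner[symmetric] using d ny
      by (simp add: power2_eq_square)
    finally show ?thesis .
  qed
  also have "\<dots> \<le> ?d" using mult_left_mono[OF ny d] less_le_trans[OF zero_less_one ny] by (simp add: pos_divide_le_eq)
  finally show ?thesis .
qed

end

text \<open>The coordinate of larger modulus determines \<open>a\<close> with its sign;
  \<open>t\<close> is that modulus, and dividing by it gives the slope.\<close>

lemma signed_frame_direction:
  fixes y :: R2
  assumes "y \<noteq> 0"
  obtains a b t v where "signed_frame a b" "t > 0" "\<bar>v\<bar> \<le> 1" "y = t *\<^sub>R (a + v *\<^sub>R b)"
proof -
  have y: "y = y $ 1 *\<^sub>R axis 1 1 + y $ 2 *\<^sub>R axis 2 1"
    by (simp add: vec_eq_iff forall_2 axis_def)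
  have n: "y $ 1 \<noteq> 0 \<or> y $ 2 \<noteq> 0" using assms by (simp add: vec_eq_iff forall_2)
  consider "\<bar>y $ 2\<bar> \<le> \<bar>y $ 1\<bar>" "y $ 1 > 0" | "\<bar>y $ 2\<bar> \<le> \<bar>y $ 1\<bar>" "y $ 1 < 0"
    | "\<bar>y $ 1\<bar> \<le> \<bar>y $ 2\<bar>" "y $ 2 > 0" | "\<bar>y $ 1\<bar> \<le> \<bar>y $ 2\<bar>" "y $ 2 < 0"
    using n by linarith
  then show ?thesis
  proof cases
    case 1
    then show ?thesis
      by (intro that[of "axis 1 1" "axis 2 1" "y $ 1" "y $ 2 / y $ 1"])
         (simp_all add: signed_frame_def vec_eq_iff forall_2 axis_def)
  next
    case 2
    then show ?thesis
      by (intro that[of "- axis 1 1" "axis 2 1" "- y $ 1" "- y $ 2 / y $ 1"])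
         (simp_all add: signed_frame_def vec_eq_iff forall_2 axis_def neg_le_divide_eq)
  next
    case 3
    then show ?thesis
      by (intro that[of "axis 2 1" "axis 1 1" "y $ 2" "y $ 1 / y $ 2"])
         (simp_all add: signed_frame_def vec_eq_iff forall_2 axis_def)
  next
    case 4
    then show ?thesis
      by (intro that[of "- axis 2 1" "axis 1 1" "- y $ 2" "- y $ 1 / y $ 2"])
         (simp_all add: signed_frame_def vec_eq_iff forall_2 axis_def neg_le_divide_eq)
  qed
qed

section \<open>From the four charts to the covering number and its exponent\<close>

context convex_domain
begin

text \<open>Restricted to frontier points with a normal in the given sector. The width is doubled
  because caps are strict while the chart covers give depth at most \<delta>.\<close>

definition caps_cover :: "R2 \<Rightarrow> R2 \<Rightarrow> real \<Rightarrow> (R2 \<times> R2 set) set \<Rightarrow> bool" where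
  "caps_cover a b \<delta> S \<longleftrightarrow> finite S \<and> (\<forall>(q, L)\<in>S. supporting_line \<Omega> q L) \<and>
     (\<forall>v x. \<bar>v\<bar> \<le> 1 \<longrightarrow> x \<in> frontier \<Omega> \<longrightarrow> x \<bullet> (a + v *\<^sub>R b) = supp (a + v *\<^sub>R b)
        \<longrightarrow> x \<in> (\<Union>(q, L)\<in>S. cap_set \<Omega> L (2 * \<delta>)))"

lemma chart_caps:
  assumes fr: "signed_frame a b"
    and bdd: "bounded_on_Lp (BR_op \<Omega> lam) p" and p: "p \<ge> 1" and lam: "lam \<ge> 0"
  shows "\<exists>C. \<forall>\<delta>. 0 < \<delta> \<longrightarrow> \<delta> \<le> 1/4 \<longrightarrow> \<delta> \<le> inr / 2 \<longrightarrow>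
     (\<exists>S. caps_cover a b \<delta> S \<and> real (card S) \<le> C * (\<delta> powr (2 / p - 2 - lam) + 1))"
proof -
  interpret convex_chart \<Omega> a b by unfold_locales (rule fr)
  obtain C where C: "\<And>\<delta>. 0 < \<delta> \<Longrightarrow> \<delta> \<le> 1/4 \<Longrightarrow> \<delta> \<le> inr / 2 \<Longrightarrow>
     (\<exists>V. finite V \<and> real (card V) \<le> C * (\<delta> powr (2 / p - 2 - lam) + 1) \<and>
       (\<forall>u x. \<bar>u\<bar> \<le> 1 \<longrightarrow> maximizer x u \<longrightarrow> (\<exists>v\<in>V. h v - x \<bullet> (a + v *\<^sub>R b) \<le> \<delta>)))"
    using chart_cover[OF bdd p lam] by blast
  show ?thesis
  proof (intro exI[of _ C] allI impI)
    fix \<delta> assume \<delta>: "0 < \<delta>" "\<delta> \<le> 1/4" "\<delta> \<le> inr / 2"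
    obtain V where V: "finite V" "real (card V) \<le> C * (\<delta> powr (2 / p - 2 - lam) + 1)"
      "\<And>u x. \<bar>u\<bar> \<le> 1 \<Longrightarrow> maximizer x u \<Longrightarrow> \<exists>v\<in>V. h v - x \<bullet> (a + v *\<^sub>R b) \<le> \<delta>"
      using C[OF \<delta>] by blast
    let ?S = "(\<lambda>v. (touch v, touch_line v)) ` V"
    have "real (card ?S) \<le> real (card V)" using card_image_le[OF V(1)] by simp
    then have "real (card ?S) \<le> C * (\<delta> powr (2 / p - 2 - lam) + 1)" using V(2) by simp
    moreover have "caps_cover a b \<delta> ?S"
      unfolding caps_cover_def
    proof (intro conjI allI impI)
      show "\<forall>(q, L)\<in>?S. supporting_line \<Omega> q L" using supporting_touch_line by auto
      fix v x assume x: "\<bar>v\<bar> \<le> 1" "x \<in> frontier \<Omega>" "x \<bullet> (a + v *\<^sub>R b) = supp (a + v *\<^sub>R b)"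
      have xc: "x \<in> closure \<Omega>" using x by (simp add: frontier_def)
      then have "maximizer x v" using x by (simp add: maximizer_def h_def)
      then obtain c where c: "c \<in> V" "h c - x \<bullet> (a + c *\<^sub>R b) \<le> \<delta>" using V(3) x(1) by blast
      have "infdist x (touch_line c) < 2 * \<delta>" using infdist_touch_line_le[OF xc, of c] c \<delta> by simp
      then show "x \<in> (\<Union>(q, L)\<in>?S. cap_set \<Omega> L (2 * \<delta>))" using c x by (auto simp: cap_set_def)
    qed (use V in simp)
    ultimately show "\<exists>S. caps_cover a b \<delta> S \<and> real (card S) \<le> C * (\<delta> powr (2 / p - 2 - lam) + 1)" by blast
  qed
qed

text \<open>Separate the point from the domain by a line; the inequality extends to the
  closure.\<close>

lemma frontier_supporting_direction:
  assumes "x \<in> frontier \<Omega>"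
  obtains y where "y \<noteq> 0" "x \<bullet> y = supp y"
proof -
  have x: "x \<in> closure \<Omega>" "x \<notin> \<Omega>" using assms open_domain by (auto simp: frontier_def interior_open)
  obtain y c where y: "y \<noteq> 0" "\<forall>\<eta>\<in>\<Omega>. y \<bullet> \<eta> \<le> c" "\<forall>\<eta>\<in>{x}. y \<bullet> \<eta> \<ge> c"
    using separating_hyperplane_sets[OF convex convex_singleton[of x]] zero x(2) by blast
  have "closure \<Omega> \<subseteq> {\<eta>. y \<bullet> \<eta> \<le> c}"
    using y(2) by (intro closure_minimal closed_halfspace_le) auto
  then have "supp y \<le> y \<bullet> x" using y(3) by (intro supp_leI) fastforce
  then show ?thesis using supp_ge[OF x(1), of y] y(1) that[of y] by (simp add: inner_commute)
qed

text \<open>Every frontier point has a supporting normal, which belongs to one of the four frames up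
  to a positive factor; the union of the four families of caps is a cover.\<close>

lemma cover_number_le:
  assumes bdd: "bounded_on_Lp (BR_op \<Omega> lam) p" and p: "p \<ge> 1" and lam: "lam \<ge> 0"
  shows "\<exists>C. \<forall>\<delta>. 0 < \<delta> \<longrightarrow> \<delta> \<le> 1/4 \<longrightarrow> \<delta> \<le> inr / 2 \<longrightarrow>
     real (cover_number \<Omega> (2 * \<delta>)) \<le> C * (\<delta> powr (2 / p - 2 - lam) + 1)"
proof -
  define F :: "(R2 \<times> R2) set" where "F = {(a, b). signed_frame a b}"
  have "F = {(axis 1 1, axis 2 1), (- axis 1 1, axis 2 1), (axis 2 1, axis 1 1), (- axis 2 1, axis 1 1)}"
    unfolding F_def signed_frame_def by auto
  then have F: "finite F" by simp
  have "\<forall>z\<in>F. \<exists>C. \<forall>\<delta>. 0 < \<delta> \<longrightarrow> \<delta> \<le> 1/4 \<longrightarrow> \<delta> \<le> inr / 2 \<longrightarrow>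
     (\<exists>S. caps_cover (fst z) (snd z) \<delta> S \<and> real (card S) \<le> C * (\<delta> powr (2 / p - 2 - lam) + 1))"
    using chart_caps[OF _ bdd p lam] by (auto simp: F_def)
  from bchoice[OF this] obtain C where C: "\<forall>z\<in>F. \<forall>\<delta>. 0 < \<delta> \<longrightarrow> \<delta> \<le> 1/4 \<longrightarrow> \<delta> \<le> inr / 2 \<longrightarrow>
     (\<exists>S. caps_cover (fst z) (snd z) \<delta> S \<and> real (card S) \<le> C z * (\<delta> powr (2 / p - 2 - lam) + 1))" ..
  show ?thesis
  proof (intro exI[of _ "\<Sum>z\<in>F. C z"] allI impI)
    fix \<delta> :: real assume \<delta>: "0 < \<delta>" "\<delta> \<le> 1/4" "\<delta> \<le> inr / 2"
    let ?X = "\<delta> powr (2 / p - 2 - lam) + 1"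
    have "\<forall>z\<in>F. \<exists>S. caps_cover (fst z) (snd z) \<delta> S \<and> real (card S) \<le> C z * ?X"
      using C \<delta> by simp
    from bchoice[OF this] obtain S where S: "\<forall>z\<in>F. caps_cover (fst z) (snd z) \<delta> (S z) \<and> real (card (S z)) \<le> C z * ?X" ..
    define T where "T = (\<Union>z\<in>F. S z)"
    have "finite T" unfolding T_def using F S by (auto simp: caps_cover_def)
    moreover have "\<forall>(q, L)\<in>T. supporting_line \<Omega> q L" unfolding T_def using S by (auto simp: caps_cover_def)
    moreover have "frontier \<Omega> \<subseteq> (\<Union>(q, L)\<in>T. cap_set \<Omega> L (2 * \<delta>))"
    proof
      fix x assume x: "x \<in> frontier \<Omega>"
      obtain y where y: "y \<noteq> 0" "x \<bullet> y = supp y" using frontier_supporting_direction[OF x] .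
      obtain a b t v where ab: "signed_frame a b" "t > 0" "\<bar>v\<bar> \<le> 1" "y = t *\<^sub>R (a + v *\<^sub>R b)"
        using signed_frame_direction[OF y(1)] .
      have "t * (x \<bullet> (a + v *\<^sub>R b)) = t * supp (a + v *\<^sub>R b)"
        using y(2) ab supp_scale[of t "a + v *\<^sub>R b"] by (simp only: inner_scaleR_right less_imp_le)
      then have "x \<bullet> (a + v *\<^sub>R b) = supp (a + v *\<^sub>R b)" using ab(2) by simp
      then have "x \<in> (\<Union>(q, L)\<in>S (a, b). cap_set \<Omega> L (2 * \<delta>))"
        using S ab x unfolding caps_cover_def F_def by fastforce
      then show "x \<in> (\<Union>(q, L)\<in>T. cap_set \<Omega> L (2 * \<delta>))" using ab by (auto simp: T_def F_def)
    qed
    ultimately have "cover_number \<Omega> (2 * \<delta>) \<le> card T"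
      unfolding cover_number_def by (intro Least_le exI[of _ T]) simp
    also have "card T \<le> (\<Sum>z\<in>F. card (S z))" unfolding T_def by (rule card_UN_le[OF F])
    finally have "real (cover_number \<Omega> (2 * \<delta>)) \<le> (\<Sum>z\<in>F. real (card (S z)))"
      by (simp flip: of_nat_sum)
    also have "\<dots> \<le> (\<Sum>z\<in>F. C z * ?X)" using S by (intro sum_mono) auto
    finally show "real (cover_number \<Omega> (2 * \<delta>)) \<le> (\<Sum>z\<in>F. C z) * ?X" by (simp add: sum_distrib_right)
  qed
qed

text \<open>Taking logarithms in the power bound for the covering number; multiplicative constants
  vanish in the limit. The maximum with 0 reflects the summand 1 in that bound, which dominates when
  the power of \<delta> does not blow up.\<close>

lemma kappa_le:
  assumes bdd: "bounded_on_Lp (BR_op \<Omega> lam) p" and p: "p \<ge> 1" and lam: "lam \<ge> 0"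
  shows "kappa \<Omega> \<le> max 0 (lam + 2 - 2 / p)"
proof -
  define g where "g = max 0 (lam + 2 - 2 / p)"
  have g: "g \<ge> 0" "2 / p - 2 - lam \<ge> - g" by (auto simp: g_def)
  obtain C where C: "\<And>\<delta>. 0 < \<delta> \<Longrightarrow> \<delta> \<le> 1/4 \<Longrightarrow> \<delta> \<le> inr / 2 \<Longrightarrow>
     real (cover_number \<Omega> (2 * \<delta>)) \<le> C * (\<delta> powr (2 / p - 2 - lam) + 1)"
    using cover_number_le[OF assms] by blast
  define B where "B = max 1 (2 * max 0 C * 2 powr g)"
  have B: "B \<ge> 1" by (simp add: B_def)
  have N: "ln (real (cover_number \<Omega> \<epsilon>)) / ln (1 / \<epsilon>) \<le> ln B / ln (1 / \<epsilon>) + g"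
    if \<epsilon>: "0 < \<epsilon>" "\<epsilon> < 1/2" "\<epsilon> < inr" for \<epsilon>
  proof -
    have l: "ln (1 / \<epsilon>) > 0" using \<epsilon> by simp
    have "real (cover_number \<Omega> \<epsilon>) \<le> C * ((\<epsilon> / 2) powr (2 / p - 2 - lam) + 1)"
      using C[of "\<epsilon> / 2"] \<epsilon> by simp
    also have "\<dots> \<le> max 0 C * ((\<epsilon> / 2) powr (- g) + (\<epsilon> / 2) powr (- g))"
    proof (intro mult_mono add_mono)
      show "(\<epsilon> / 2) powr (2 / p - 2 - lam) \<le> (\<epsilon> / 2) powr (- g)" using \<epsilon> g by (intro powr_mono') auto
      show "1 \<le> (\<epsilon> / 2) powr (- g)" using \<epsilon> g powr_mono'[of "- g" 0 "\<epsilon> / 2"] by simp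
    qed auto
    also have "\<dots> = 2 * max 0 C * 2 powr g * \<epsilon> powr (- g)"
      using \<epsilon> by (simp add: powr_divide powr_minus field_simps)
    also have "\<dots> \<le> B * \<epsilon> powr (- g)" by (intro mult_right_mono) (simp_all add: B_def)
    finally have le: "real (cover_number \<Omega> \<epsilon>) \<le> B * \<epsilon> powr (- g)" .
    have "ln (real (cover_number \<Omega> \<epsilon>)) \<le> ln B + g * ln (1 / \<epsilon>)"
    \<comment> \<open>A zero value is harmless since \<open>ln 0 = 0\<close>, and the right-hand
      side is nonnegative by \<open>B \<ge> 1\<close>.\<close>
    proof (cases "cover_number \<Omega> \<epsilon> = 0")
      case True
      then show ?thesis using B g l by simp
    next
      case False
      then have "ln (real (cover_number \<Omega> \<epsilon>)) \<le> ln (B * \<epsilon> powr (- g))" using le by (subst ln_le_cancel_iff) auto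
      also have "\<dots> = ln B + g * ln (1 / \<epsilon>)" using B \<epsilon> by (simp add: ln_mult ln_powr ln_div)
      finally show ?thesis .
    qed
    then show ?thesis using l by (simp add: field_simps)
  qed
  have lim: "((\<lambda>\<epsilon>. ln B / ln (1 / \<epsilon>) + g) \<longlongrightarrow> 0 + g) (at_right 0)"
  proof (intro tendsto_add tendsto_const real_tendsto_divide_at_top[OF tendsto_const])
    have "filterlim (\<lambda>\<epsilon>::real. ln (1 / \<epsilon>)) at_top (at_right 0)"
      using filterlim_compose[OF ln_at_top filterlim_inverse_at_top_right] by (simp add: inverse_eq_divide)
    then show "filterlim (\<lambda>\<epsilon>::real. ln (1 / \<epsilon>)) at_top (at_right 0)" .
  qed
  let ?L = "Limsup (at_right 0) (\<lambda>\<delta>. ereal (ln (real (cover_number \<Omega> \<delta>)) / ln (1 / \<delta>)))"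
  have "?L \<le> Limsup (at_right 0) (\<lambda>\<epsilon>. ereal (ln B / ln (1 / \<epsilon>) + g))"
  proof (rule Limsup_mono)
    have "eventually (\<lambda>\<epsilon>. \<epsilon> \<in> {0<..<min (1/2) inr}) (at_right 0)"
      using inr by (intro eventually_at_right_real) auto
    then show "\<forall>\<^sub>F \<epsilon> in at_right 0. ereal (ln (real (cover_number \<Omega> \<epsilon>)) / ln (1 / \<epsilon>)) \<le> ereal (ln B / ln (1 / \<epsilon>) + g)"
      by eventually_elim (simp add: N)
  qed
  also have "\<dots> = ereal g"
    using lim by (intro lim_imp_Limsup) (simp_all add: trivial_limit_at_right_real)
  finally have "?L \<le> ereal g" .
  \<comment> \<open>Were the limsup minus infinity, \<open>real_of_ereal\<close> would return 0;
    this is where \<open>g \<ge> 0\<close> enters.\<close>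
  then show ?thesis unfolding kappa_def g_def[symmetric] using g(1) by (cases ?L) auto
qed

end

section \<open>Unboundedness of the operators and the bound on the critical exponent\<close>

theorem theorem1p3:
  fixes \<Omega> :: "(real ^ 2) set" and p lam :: real
  assumes "1 \<le> p" "p \<le> 2"
    and "bounded \<Omega>" "open \<Omega>" "convex \<Omega>" "0 \<in> \<Omega>"
    and "0 \<le> lam"
  shows "(lam < 1 / p - 1 + kappa \<Omega> / 2 \<longrightarrow> \<not> bounded_on_Lp (BR_op \<Omega> lam) p)
         \<and> p_crit \<Omega> \<ge> 2 / (2 - kappa \<Omega>)"
proof (intro conjI impI notI)
  interpret convex_domain \<Omega> using assms by unfold_locales
  show False if lt: "lam < 1 / p - 1 + kappa \<Omega> / 2" and bdd: "bounded_on_Lp (BR_op \<Omega> lam) p"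
  proof -
    \<comment> \<open>In the first case \<open>lam < 1 / p - 1 \<le> 0\<close>, in the second
      \<open>lam < lam / 2\<close>; both contradict \<open>lam \<ge> 0\<close>.\<close>
    have "kappa \<Omega> \<le> 0 \<or> kappa \<Omega> \<le> lam + 2 - 2 * (1 / p)"
      using kappa_le[OF bdd assms(1) assms(7)] by auto
    moreover have "1 / p \<le> 1" using assms(1) by simp
    ultimately show ?thesis using lt assms(7) by argo
  qed
  show "p_crit \<Omega> \<ge> 2 / (2 - kappa \<Omega>)"
    unfolding p_crit_def
  proof (rule cInf_greatest)
    have "2 \<in> {p. 1 \<le> p \<and> (\<forall>lam>0. bounded_on_Lp (BR_op \<Omega> lam) p)}" using bounded_on_L2 by simp
    then show "{p. 1 \<le> p \<and> (\<forall>lam>0. bounded_on_Lp (BR_op \<Omega> lam) p)} \<noteq> {}" by blast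
    fix q assume "q \<in> {p. 1 \<le> p \<and> (\<forall>lam>0. bounded_on_Lp (BR_op \<Omega> lam) p)}"
    then have q: "1 \<le> q" and bdd: "\<And>lam. lam > 0 \<Longrightarrow> bounded_on_Lp (BR_op \<Omega> lam) q" by auto
    \<comment> \<open>Boundedness for every positive \<open>lam\<close> allows
      \<open>lam = e\<close> with \<open>e\<close> arbitrarily small.\<close>
    have "kappa \<Omega> \<le> (2 - 2 / q) + e" if "e > 0" for e
    proof -
      have "2 / q \<le> 2" using q by (simp add: divide_le_eq)
      then show ?thesis using kappa_le[OF bdd[OF that] q] that by simp
    qed
    then have "kappa \<Omega> \<le> 2 - 2 / q" by (rule field_le_epsilon)
    then have k: "2 / q \<le> 2 - kappa \<Omega>" by simp
    moreover have "2 / q > 0" using q by simp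
    ultimately have "2 - kappa \<Omega> > 0" by linarith
    then show "2 / (2 - kappa \<Omega>) \<le> q" using k q by (simp add: pos_divide_le_eq mult.commute)
  qed
qed

end
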